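(* Let $(\Omega,\Sigma,\mu)$ be a probability space such that $\mu$ is not purely atomic, let $E$ be an order continuous Köthe function space over $(\Omega,\Sigma,\mu)$, and let $X$ be a Banach space. Suppose that the closed unit ball $B_{E^*(X^* )}$ of $E^*(X^* )$, regarded as a subset of $B_{E(X)^*}$, is a James boundary for $E(X)$. Then $X^*$ has the Radon-Nikodým property.
   Context: All Banach spaces are real. For a Banach space $Z$, $B_Z$ denotes its closed unit ball and $Z^*$ its topological dual; $\langle z^*,z\rangle$ denotes the evaluation of $z^*\in Z^*$ at $z\in Z$. A Köthe function space over a probability space $(\Omega,\Sigma,\mu)$ is a Banach space $E$ consisting of ($\mu$-a.e. equivalence classes of) $\mu$-integrable real-valued functions on $\Omega$ such that: (i) $\chi_A\in E$ for every $A\in\Sigma$; (ii) if $f$ is a $\mu$-measurable real-valued function on $\Omega$, $g\in E$ and $|f|\le |g|$ $\mu$-a.e., then $f\in E$ and $\|f\|_E\le\|g\|_E$. $E$ is order continuous if $\|f_\alpha\|_E\to 0$ for every decreasing net $(f_\alpha)$ in $E$ with $\inf f_\alpha=0$. When $E$ is order continuous, $E^*$ is also a Köthe function space over $(\Omega,\Sigma,\mu)$: it is identified with the space of (classes of) $\mu$-measurable functions $g$ such that $fg\in L_1(\mu)$ for all $f\in E$, acting by $\langle g,f\rangle=\int_\Omega fg\,d\mu$ and equipped with the dual norm. A function $f:\Omega\to Z$ with values in a Banach space $Z$ is strongly $\mu$-measurable if it is the $\mu$-a.e. pointwise norm limit of a sequence of simple functions, i.e. functions of the form $\sum_{i=0}^p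 z_i\chi_{A_i}$ with $z_i\in Z$, $A_i\in\Sigma$. For a Köthe function space $E$ over $(\Omega,\Sigma,\mu)$ and a Banach space $X$, the Köthe-Bochner space $E(X)$ is the Banach space of all ($\mu$-a.e. equivalence classes of) strongly $\mu$-measurable functions $f:\Omega\to X$ such that $\|f(\cdot)\|_X\in E$, with norm $\|f\|_{E(X)}:=\big\|\,\|f(\cdot)\|_X\,\big\|_E$. The space $E^*(X^* )$ is defined in the same way from the Köthe function space $E^*$ and the Banach space $X^*$. For $E$ order continuous, $E^*(X^* )$ is identified with a (norming) subspace of $E(X)^*$ via the duality $\langle g,f\rangle=\int_\Omega\langle g(\cdot),f(\cdot)\rangle\,d\mu$ for $g\in E^*(X^* )$, $f\in E(X)$. For a Banach space $Z$, a set $H\subseteq B_{Z^*}$ is a James boundary for $Z$ if for every $z\in Z$ there is $z^*\in H$ such that $\|z\|_Z=\langle z^*,z\rangle$. *)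

theory Defs
  imports "HOL-Probability.Probability"
begin

text \<open>
  Spaces of \<mu>-a.e. equivalence classes are represented by the set of all representatives of their
  elements, together with a norm function on representatives. Thus "zero" and "order" mean
  a.e. zero and a.e. order. A scalar function is \<mu>-measurable iff it is Borel measurable with
  respect to the completion of \<mu>, i.e. iff it is a.e. equal to a \<Sigma>-measurable function; on the
  scalars this is the same notion as \<open>strongly_measurable\<close> below.
\<close>

definition atom :: "'a measure \<Rightarrow> 'a set \<Rightarrow> bool" where
  "atom M A \<longleftrightarrow> A \<in> sets M \<and> emeasure M A > 0 \<and>
     (\<forall>B\<in>sets M. B \<subseteq> A \<longrightarrow> emeasure M B = 0 \<or> emeasure M (A - B) = 0)"

definition purely_atomic :: "'a measure \<Rightarrow> bool" where
  "purely_atomic M \<longleftrightarrow>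
     (\<forall>A\<in>sets M. emeasure M A > 0 \<longrightarrow> (\<exists>B. B \<subseteq> A \<and> atom M B))"

locale kothe_function_space = prob_space M
  for M :: "'a measure" +
  fixes E :: "('a \<Rightarrow> real) set" and N :: "('a \<Rightarrow> real) \<Rightarrow> real"
  assumes integrable: "f \<in> E \<Longrightarrow> integrable (completion M) f"
    and add_closed: "f \<in> E \<Longrightarrow> g \<in> E \<Longrightarrow> (\<lambda>x. f x + g x) \<in> E"
    and scale_closed: "f \<in> E \<Longrightarrow> (\<lambda>x. c * f x) \<in> E"
    and norm_eq_0_iff: "f \<in> E \<Longrightarrow> N f = 0 \<longleftrightarrow> (AE x in M. f x = 0)"
    and norm_triangle: "f \<in> E \<Longrightarrow> g \<in> E \<Longrightarrow> N (\<lambda>x. f x + g x) \<le> N f + N g"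
    and norm_scale: "f \<in> E \<Longrightarrow> N (\<lambda>x. c * f x) = \<bar>c\<bar> * N f"
    and complete: "(\<And>n. u n \<in> E) \<Longrightarrow>
        (\<And>e. e > 0 \<Longrightarrow> \<exists>n0. \<forall>m\<ge>n0. \<forall>n\<ge>n0. N (\<lambda>x. u m x - u n x) < e) \<Longrightarrow>
        \<exists>f\<in>E. (\<lambda>n. N (\<lambda>x. u n x - f x)) \<longlonglongrightarrow> 0"
    and indicator: "A \<in> sets M \<Longrightarrow> indicat_real A \<in> E"
    and solid: "f \<in> borel_measurable (completion M) \<Longrightarrow> g \<in> E \<Longrightarrow>
        (AE x in M. \<bar>f x\<bar> \<le> \<bar>g x\<bar>) \<Longrightarrow> f \<in> E"
    and norm_mono: "f \<in> borel_measurable (completion M) \<Longrightarrow> g \<in> E \<Longrightarrow>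
        (AE x in M. \<bar>f x\<bar> \<le> \<bar>g x\<bar>) \<Longrightarrow> N f \<le> N g"

text \<open>
  A net is a family indexed by a nonempty set \<open>I\<close> with a directed preorder \<open>r\<close>.
  Since HOL does not quantify over types inside a formula, the indices are taken from
  the type of functions on \<open>\<Omega>\<close>. This loses no generality: every decreasing net in \<open>E\<close> may be
  replaced by its range, indexed by itself and directed downwards by the a.e. order; this keeps
  the infimum, and if the norms tend to 0 along the range then they do so along the original net.
\<close>

definition order_continuous ::
    "'a measure \<Rightarrow> ('a \<Rightarrow> real) set \<Rightarrow> (('a \<Rightarrow> real) \<Rightarrow> real) \<Rightarrow> bool" where
  "order_continuous M E N \<longleftrightarrow>
     (\<forall>(I :: ('a \<Rightarrow> real) set) r u.
        I \<noteq> {} \<longrightarrow> preorder_on I r \<longrightarrow>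
        (\<forall>i\<in>I. \<forall>j\<in>I. \<exists>k\<in>I. (i, k) \<in> r \<and> (j, k) \<in> r) \<longrightarrow>
        (\<forall>i\<in>I. u i \<in> E) \<longrightarrow>
        (\<forall>i j. (i, j) \<in> r \<longrightarrow> (AE x in M. u j x \<le> u i x)) \<longrightarrow>
        (\<forall>i\<in>I. AE x in M. 0 \<le> u i x) \<longrightarrow>
        (\<forall>g\<in>E. (\<forall>i\<in>I. AE x in M. g x \<le> u i x) \<longrightarrow> (AE x in M. g x \<le> 0)) \<longrightarrow>
        (\<forall>e>0. \<exists>i\<in>I. \<forall>j. (i, j) \<in> r \<longrightarrow> N (u j) < e))"

definition kothe_dual :: "'a measure \<Rightarrow> ('a \<Rightarrow> real) set \<Rightarrow> ('a \<Rightarrow> real) set" where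
  "kothe_dual M E = {g \<in> borel_measurable (completion M).
     \<forall>f\<in>E. integrable (completion M) (\<lambda>x. f x * g x)}"

definition kothe_dual_norm ::
    "'a measure \<Rightarrow> ('a \<Rightarrow> real) set \<Rightarrow> (('a \<Rightarrow> real) \<Rightarrow> real) \<Rightarrow> ('a \<Rightarrow> real) \<Rightarrow> real" where
  "kothe_dual_norm M E N g =
     (SUP f\<in>{f \<in> E. N f \<le> 1}. \<bar>LINT x|completion M. f x * g x\<bar>)"

definition strongly_measurable :: "'a measure \<Rightarrow> ('a \<Rightarrow> 'z::real_normed_vector) \<Rightarrow> bool" where
  "strongly_measurable M f \<longleftrightarrow>
     (\<exists>s. (\<forall>n. simple_function M (s n)) \<and> (AE x in M. (\<lambda>n. s n x) \<longlonglongrightarrow> f x))"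

definition kothe_bochner ::
    "'a measure \<Rightarrow> ('a \<Rightarrow> real) set \<Rightarrow> ('a \<Rightarrow> 'z::real_normed_vector) set" where
  "kothe_bochner M E = {f. strongly_measurable M f \<and> (\<lambda>x. norm (f x)) \<in> E}"

definition kothe_bochner_norm ::
    "(('a \<Rightarrow> real) \<Rightarrow> real) \<Rightarrow> ('a \<Rightarrow> 'z::real_normed_vector) \<Rightarrow> real" where
  "kothe_bochner_norm N f = N (\<lambda>x. norm (f x))"

definition kothe_bochner_functional ::
    "'a measure \<Rightarrow> ('a \<Rightarrow> 'z::real_normed_vector \<Rightarrow>\<^sub>L real) \<Rightarrow> ('a \<Rightarrow> 'z) \<Rightarrow> real" where
  "kothe_bochner_functional M g f = (LINT x|completion M. blinfun_apply (g x) (f x))"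

text \<open>
  \<open>V\<close> is (the set of representatives of) a normed space of functions with norm \<open>N\<close>; functionals
  matter only through their values on \<open>V\<close>. The bound by \<open>N\<close> makes them well defined on classes.
\<close>

definition dual_unit_ball ::
    "('a \<Rightarrow> 'z::real_normed_vector) set \<Rightarrow> (('a \<Rightarrow> 'z) \<Rightarrow> real) \<Rightarrow> (('a \<Rightarrow> 'z) \<Rightarrow> real) set" where
  "dual_unit_ball V N = {\<phi>.
     (\<forall>f\<in>V. \<forall>g\<in>V. \<phi> (\<lambda>x. f x + g x) = \<phi> f + \<phi> g) \<and>
     (\<forall>f\<in>V. \<forall>c. \<phi> (\<lambda>x. c *\<^sub>R f x) = c * \<phi> f) \<and>
     (\<forall>f\<in>V. \<bar>\<phi> f\<bar> \<le> N f)}"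

definition james_boundary ::
    "('a \<Rightarrow> 'z::real_normed_vector) set \<Rightarrow> (('a \<Rightarrow> 'z) \<Rightarrow> real) \<Rightarrow>
     (('a \<Rightarrow> 'z) \<Rightarrow> real) set \<Rightarrow> bool" where
  "james_boundary V N H \<longleftrightarrow> H \<subseteq> dual_unit_ball V N \<and> (\<forall>f\<in>V. \<exists>\<phi>\<in>H. N f = \<phi> f)"

text \<open>
  The library's Bochner integral requires a second countable (separable) range space, which is too
  restrictive for dual spaces. The following is the library's definition, with Borel
  measurability replaced by strong measurability.
\<close>

definition has_strong_bochner_integral ::
    "'a measure \<Rightarrow> ('a \<Rightarrow> 'z::real_normed_vector) \<Rightarrow> 'z \<Rightarrow> bool" where
  "has_strong_bochner_integral M f z \<longleftrightarrow> strongly_measurable M f \<and>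
     (\<exists>s. (\<forall>n. Bochner_Integration.simple_bochner_integrable M (s n)) \<and>
          (\<lambda>n. \<integral>\<^sup>+x. norm (f x - s n x) \<partial>completion M) \<longlonglongrightarrow> 0 \<and>
          (\<lambda>n. Bochner_Integration.simple_bochner_integral M (s n)) \<longlonglongrightarrow> z)"

definition vector_measure :: "'a measure \<Rightarrow> ('a set \<Rightarrow> 'z::real_normed_vector) \<Rightarrow> bool" where
  "vector_measure M F \<longleftrightarrow>
     (\<forall>A. range A \<subseteq> sets M \<longrightarrow> disjoint_family A \<longrightarrow>
          (\<lambda>n::nat. F (A n)) sums F (\<Union>n. A n))"

definition bounded_variation :: "'a measure \<Rightarrow> ('a set \<Rightarrow> 'z::real_normed_vector) \<Rightarrow> bool" where
  "bounded_variation M F \<longleftrightarrow>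
     (\<exists>C. \<forall>P. finite P \<longrightarrow> P \<subseteq> sets M \<longrightarrow> partition_on (space M) P \<longrightarrow>
          (\<Sum>A\<in>P. norm (F A)) \<le> C)"

definition continuous_wrt_measure ::
    "'a measure \<Rightarrow> ('a set \<Rightarrow> 'z::real_normed_vector) \<Rightarrow> bool" where
  "continuous_wrt_measure M F \<longleftrightarrow>
     (\<forall>e>0. \<exists>d>0. \<forall>A\<in>sets M. measure M A < d \<longrightarrow> norm (F A) < e)"

text \<open>
  The Radon-Nikodym property quantifies over all finite measure spaces. As HOL cannot quantify over
  the type of the points inside a formula, this type is a parameter; a theorem concluding
  \<open>radon_nikodym_property TYPE('b) TYPE('z)\<close> with an otherwise unused type variable \<open>'b\<close>
  asserts the property for measure spaces over all types.
\<close>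

definition radon_nikodym_property :: "'b itself \<Rightarrow> 'z::banach itself \<Rightarrow> bool" where
  "radon_nikodym_property _ _ \<longleftrightarrow>
     (\<forall>(M :: 'b measure) (F :: 'b set \<Rightarrow> 'z).
        finite_measure M \<longrightarrow> vector_measure M F \<longrightarrow> bounded_variation M F \<longrightarrow>
        continuous_wrt_measure M F \<longrightarrow>
        (\<exists>g. \<forall>A\<in>sets M.
           has_strong_bochner_integral M (\<lambda>x. indicator A x *\<^sub>R g x) (F A)))"

end

theory Submission
  imports Defs
begin

text \<open>
  Suppose that the dual \<open>X\<^sup>*\<close> fails the Radon-Nikodym property, and let \<open>F\<close> be an absolutely
  continuous vector measure of bounded variation over some \<open>(S, \<nu>)\<close> that has no density. If every
  set of positive measure contained pieces on which the averages \<open>F A / \<nu> A\<close> are almost constant,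
  these pieces would exhaust \<open>S\<close> and the resulting step functions would converge to a density
  (\<open>density_of_small_oscillation\<close>). So there are \<open>\<epsilon> > 0\<close> and a set of positive measure all of
  whose pieces have averages that oscillate by more than \<open>\<epsilon>\<close>. On each piece a vector \<open>h\<close> of the
  unit ball of \<open>X\<close> sees this oscillation, and a Hahn argument finds two smaller pieces such that
  \<open>F A h\<close> is at least \<open>(c + \<epsilon>) \<nu> A\<close> inside the first one and at most \<open>c \<nu> A\<close> inside the second
  one. Iteration yields a tree of vectors \<open>h\<^sub>s\<close> and functionals \<open>e\<^sub>r\<close> (the averages over the
  nodes), indexed by finite binary sequences, such that \<open>e\<^sub>r h\<^sub>s\<close> is at least \<open>c\<^sub>s + \<epsilon>\<close> or at most
  \<open>c\<^sub>s\<close>, according to the branch that leads from \<open>s\<close> to the later node \<open>r\<close>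
  (\<open>not_radon_nikodym_tree\<close>).

  The atomless part of \<open>\<mu>\<close> carries a binary tree of sets \<open>A\<^sub>s\<close>, each of which is split into two
  parts of comparable measure. Let \<open>haar\<^sub>s\<close> be the Haar function that is constant on the two
  halves of \<open>A\<^sub>s\<close> and has integral zero, and let \<open>f\<^sub>n\<close> be the sum of the functions \<open>haar\<^sub>s h\<^sub>s\<close>
  over the sequences \<open>s\<close> of length \<open>n\<close>. Two things happen at once. Composed with a fixed
  functional, the \<open>f\<^sub>n\<close> are bounded and orthogonal in \<open>L\<^sub>2\<close>, so Bessel's inequality makes their
  integrals over any set tend to 0; approximating by simple functions, \<open>\<langle>g, f\<^sub>n\<rangle>\<close> tends to 0 for
  every \<open>g\<close> in \<open>E\<^sup>*(X\<^sup>*)\<close> (\<open>haar_sum_weakly_null\<close>). On the other hand, pair \<open>f\<^sub>n\<close> with the step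
  function that equals \<open>e\<^sub>r\<close> on \<open>A\<^sub>r\<close>, for the \<open>r\<close> of some length larger than \<open>n\<close>: as \<open>haar\<^sub>s\<close> has
  integral zero the constants \<open>c\<^sub>s\<close> cancel, and the gap \<open>\<epsilon>\<close> leaves a lower bound that does not
  depend on \<open>n\<close>. Hence convex combinations of the \<open>f\<^sub>n\<close> cannot be small in \<open>L\<^sub>1(X)\<close>
  (\<open>integral_haar_sum_lower_bound\<close>), and if the tree is placed well they cannot be small in \<open>E(X)\<close>
  (\<open>boundary_lower_bound\<close>).

  This contradicts Simons' theorem that a sequence which tends to 0 at every element of a James
  boundary has convex combinations of arbitrarily small norm (\<open>james_boundary_null_sequence\<close>).
\<close>

section \<open>Exhaustion by small pieces, and splitting of atomless sets\<close>

text \<open>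
  Greedy choice: from what is left of \<open>B\<close>, remove a piece with property \<open>P\<close> whose measure is at
  least half of the measure of any other such piece. The measures of the removed pieces tend to 0,
  so no piece with property \<open>P\<close> and positive measure can remain, and what remains is a null set.
\<close>

lemma (in finite_measure) exhaustion:
  assumes B: "B \<in> sets M"
    and ex: "\<forall>C\<in>sets M. C \<subseteq> B \<longrightarrow> measure M C > 0 \<longrightarrow>
      (\<exists>A\<in>sets M. A \<subseteq> C \<and> measure M A > 0 \<and> P A)"
  shows "\<exists>D :: nat \<Rightarrow> 'a set. (\<forall>n. D n \<in> sets M) \<and> disjoint_family D \<and> (\<forall>n. D n \<subseteq> B) \<and>
    (\<forall>n. D n = {} \<or> measure M (D n) > 0 \<and> P (D n)) \<and> measure M (B - (\<Union>n. D n)) = 0"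
proof -
  define Q where "Q A \<longleftrightarrow> A \<in> sets M \<and> (A = {} \<or> measure M A > 0 \<and> P A)" for A
  \<comment> \<open>The empty set satisfies \<open>Q\<close>, so that a choice is possible even when \<open>C\<close> has no piece
      with \<open>P\<close>.\<close>
  have "\<exists>A. A \<subseteq> C \<and> Q A \<and> (\<forall>A'. A' \<subseteq> C \<longrightarrow> Q A' \<longrightarrow> measure M A' \<le> 2 * measure M A)" for C
  proof -
    define S where "S = measure M ` {A. A \<subseteq> C \<and> Q A}"
    have "measure M {} \<in> S" unfolding S_def Q_def by blast
    then have S0: "0 \<in> S" by simp
    have bdd: "bdd_above S"
      unfolding S_def by (intro bdd_aboveI[of _ "measure M (space M)"]) (auto intro: bounded_measure)
    have up: "measure M A' \<le> Sup S" if "A' \<subseteq> C" "Q A'" for A'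
      using that bdd by (intro cSup_upper) (auto simp: S_def)
    show ?thesis
    proof (cases "Sup S > 0")
      case True
      then have "Sup S / 2 < Sup S" by simp
      then obtain x where "x \<in> S" "Sup S / 2 < x"
        using S0 by (metis empty_iff less_cSupE)
      then obtain A where "A \<subseteq> C" "Q A" "Sup S / 2 < measure M A" unfolding S_def by auto
      then have "measure M A' \<le> 2 * measure M A" if "A' \<subseteq> C" "Q A'" for A'
        using up[OF that] by linarith
      with \<open>A \<subseteq> C\<close> \<open>Q A\<close> show ?thesis by blast
    next
      case False
      then have "measure M A' \<le> 2 * measure M {}" if "A' \<subseteq> C" "Q A'" for A'
        using up[OF that] by simp
      then show ?thesis by (intro exI[of _ "{}"]) (auto simp: Q_def)
    qed
  qed
  then obtain pick where pick: "\<And>C. pick C \<subseteq> C" "\<And>C. Q (pick C)"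
    "\<And>C A'. A' \<subseteq> C \<Longrightarrow> Q A' \<Longrightarrow> measure M A' \<le> 2 * measure M (pick C)"
    by metis
  define R where "R = rec_nat B (\<lambda>_ C. C - pick C)"
  define D where "D n = pick (R n)" for n
  have R0: "R 0 = B" and RS: "R (Suc n) = R n - D n" for n
    by (simp_all add: R_def D_def)
  have Rdec: "R n \<subseteq> R m" if "m \<le> n" for m n
    by (rule lift_Suc_antimono_le[OF _ that]) (auto simp: RS)
  have DR: "D n \<subseteq> R n" for n by (simp add: D_def pick)
  have Dsets: "D n \<in> sets M" for n using pick(2)[of "R n"] by (simp add: D_def Q_def)
  have Ddisj: "D m \<inter> D n = {}" if "m < n" for m n
    using DR[of n] Rdec[of "Suc m" n] RS[of m] that by auto
  then have disj: "disjoint_family D"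
    unfolding disjoint_family_on_def by (metis Int_commute linorder_neqE_nat)
  have rest: "B - (\<Union>n. D n) \<subseteq> R n" for n
    by (induction n) (auto simp: R0 RS)
  have "measure M (B - (\<Union>n. D n)) = 0"
  proof (rule ccontr)
    assume "measure M (B - (\<Union>n. D n)) \<noteq> 0"
    then obtain A where A: "A \<in> sets M" "A \<subseteq> B - (\<Union>n. D n)" "measure M A > 0" "P A"
      using ex[rule_format, of "B - (\<Union>n. D n)"] B Dsets by (auto simp: zero_less_measure_iff)
    have "measure M A \<le> 2 * measure M (D n)" for n
      unfolding D_def using A rest[of n] by (intro pick(3)) (auto simp: Q_def)
    moreover have "(\<lambda>n. 2 * measure M (D n)) \<longlonglongrightarrow> 2 * 0"
      by (intro tendsto_intros summable_LIMSEQ_zero sums_summable[OF finite_measure_UNION])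
        (use Dsets disj in auto)
    ultimately have "measure M A \<le> 0"
      by (metis LIMSEQ_le_const mult_zero_right)
    with A show False by simp
  qed
  moreover have "D n \<subseteq> B" for n using DR[of n] Rdec[of 0 n] R0 by auto
  moreover have "D n = {} \<or> measure M (D n) > 0 \<and> P (D n)" for n
    using pick(2)[of "R n"] by (simp add: D_def Q_def)
  ultimately show ?thesis using Dsets disj by (intro exI[of _ D]) blast
qed

lemma (in finite_measure) small_subset_of_atomless:
  assumes A: "A \<in> sets M" "measure M A > 0" and na: "\<And>B. B \<subseteq> A \<Longrightarrow> \<not> atom M B" and "\<delta> > 0"
  shows "\<exists>B\<in>sets M. B \<subseteq> A \<and> measure M B > 0 \<and> measure M B < \<delta>"
proof -
  have half: "\<exists>C'\<in>sets M. C' \<subseteq> C \<and> measure M C' > 0 \<and> measure M C' \<le> measure M C / 2"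
    if C: "C \<in> sets M" "C \<subseteq> A" "measure M C > 0" for C
  proof -
    have "emeasure M C > 0" using C by (simp add: emeasure_eq_measure)
    then obtain B where B: "B \<in> sets M" "B \<subseteq> C" "measure M B > 0" "measure M (C - B) > 0"
      using na[OF C(2)] C(1) unfolding atom_def
      by (auto simp: emeasure_eq_measure zero_less_measure_iff)
    moreover have "measure M (C - B) = measure M C - measure M B"
      using B C by (intro finite_measure_Diff) auto
    ultimately have "measure M B \<le> measure M C / 2 \<or> measure M (C - B) \<le> measure M C / 2"
      by linarith
    then show ?thesis
    proof
      assume "measure M B \<le> measure M C / 2"
      with B show ?thesis by blast
    next
      assume "measure M (C - B) \<le> measure M C / 2"
      moreover have "C - B \<in> sets M" "C - B \<subseteq> C" using B C by auto
      ultimately show ?thesis using B(4) by blast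
    qed
  qed
  have "\<exists>C\<in>sets M. C \<subseteq> A \<and> measure M C > 0 \<and> measure M C \<le> measure M A / 2 ^ n" for n
  proof (induction n)
    case 0
    then show ?case using A by auto
  next
    case (Suc n)
    then obtain C where C: "C \<in> sets M" "C \<subseteq> A" "measure M C > 0" "measure M C \<le> measure M A / 2 ^ n"
      by blast
    from half[OF C(1-3)] obtain C' where "C' \<in> sets M" "C' \<subseteq> C" "measure M C' > 0"
      "measure M C' \<le> measure M C / 2" by blast
    moreover from this C have "measure M C' \<le> measure M A / 2 ^ Suc n"
      using divide_right_mono[OF C(4), of 2] by simp
    ultimately show ?case using C by blast
  qed
  moreover obtain n where "measure M A / 2 ^ n < \<delta>"
    using real_arch_pow[of 2 "measure M A / \<delta>"] \<open>\<delta> > 0\<close> by (auto simp: field_simps)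
  ultimately show ?thesis by (meson le_less_trans)
qed

text \<open>
  Exhaust \<open>A\<close> by pieces of measure less than a third of that of \<open>A\<close>. The first finite union of
  these pieces that reaches one third has not passed two thirds. For the trees below such a
  division in bounded proportion serves as well as a division into equal halves.
\<close>

lemma (in finite_measure) split_atomless:
  assumes A: "A \<in> sets M" and na: "\<And>B. B \<subseteq> A \<Longrightarrow> \<not> atom M B"
  shows "\<exists>B\<in>sets M. B \<subseteq> A \<and> measure M A / 3 \<le> measure M B \<and> measure M B \<le> 2 * measure M A / 3"
proof (cases "measure M A = 0")
  case True
  then show ?thesis by (intro bexI[of _ "{}"]) auto
next
  case False
  then have pos: "measure M A > 0" by (simp add: zero_less_measure_iff)
  have dense: "\<forall>C\<in>sets M. C \<subseteq> A \<longrightarrow> measure M C > 0 \<longrightarrow>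
    (\<exists>B\<in>sets M. B \<subseteq> C \<and> measure M B > 0 \<and> measure M B < measure M A / 3)"
    by (intro ballI impI small_subset_of_atomless) (use na pos in auto)
  obtain D :: "nat \<Rightarrow> 'a set" where D: "\<And>n. D n \<in> sets M" "disjoint_family D" "\<And>n. D n \<subseteq> A"
    "\<And>n. D n = {} \<or> measure M (D n) > 0 \<and> measure M (D n) < measure M A / 3"
    "measure M (A - (\<Union>n. D n)) = 0"
    using exhaustion[OF A dense] by (elim exE conjE) (rule that; (erule spec | assumption))
  have small: "measure M (D n) < measure M A / 3" for n
    using D(4)[of n] pos by auto
  define U where "U n = (\<Union>i<n. D i)" for n
  have U: "U n \<in> sets M" "U n \<subseteq> A" for n unfolding U_def using D by auto
  have US: "measure M (U (Suc n)) \<le> measure M (U n) + measure M (D n)" for n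
    using measure_Un_le[OF U(1)[of n] D(1)[of n]] by (simp add: U_def lessThan_Suc Un_commute)
  have "measure M A = measure M (\<Union>n. D n)"
    using finite_measure_Diff[of A "\<Union>n. D n"] A D by (auto simp: UN_least)
  moreover have "(\<lambda>n. measure M (U n)) \<longlonglongrightarrow> measure M (\<Union>n. U n)"
    using U by (intro finite_Lim_measure_incseq) (auto simp: incseq_def U_def intro: less_le_trans)
  moreover have "(\<Union>n. U n) = (\<Union>n. D n)" unfolding U_def by auto
  ultimately have "(\<lambda>n. measure M (U n)) \<longlonglongrightarrow> measure M A" by simp
  then have "\<forall>\<^sub>F n in sequentially. measure M A / 3 < measure M (U n)"
    by (rule order_tendstoD) (use pos in simp)
  then have ex: "\<exists>n. measure M A / 3 \<le> measure M (U n)"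
    by (auto simp: eventually_sequentially intro: less_imp_le)
  define n where "n = (LEAST n. measure M A / 3 \<le> measure M (U n))"
  have n: "measure M A / 3 \<le> measure M (U n)" unfolding n_def using ex by (rule LeastI_ex)
  then have "n \<noteq> 0" using pos by (auto simp: U_def intro: gr0I)
  then obtain m where m: "n = Suc m" using not0_implies_Suc by blast
  then have "measure M (U m) < measure M A / 3"
    using not_less_Least[of m "\<lambda>n. measure M A / 3 \<le> measure M (U n)"] by (simp add: n_def)
  with n m US[of m] small[of m] have "measure M (U n) \<le> 2 * measure M A / 3" by simp
  with n U show ?thesis by blast
qed

section \<open>Countably additive set functions\<close>

lemma vector_measure_empty:
  assumes "vector_measure M F"
  shows "F {} = 0"
proof -
  have "(\<lambda>n::nat. F {}) sums F (\<Union>n::nat. {})"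
    using assms unfolding vector_measure_def
    by (elim allE[of _ "\<lambda>_. {}"]) (auto simp: disjoint_family_on_def)
  then show ?thesis
    by (metis summable_const_iff sums_summable)
qed

lemma vector_measure_UN:
  assumes F: "vector_measure M F" and "finite I" "\<And>i. i \<in> I \<Longrightarrow> A i \<in> sets M" "disjoint_family_on A I"
  shows "F (\<Union>i\<in>I. A i) = (\<Sum>i\<in>I. F (A i))"
proof -
  obtain e n where e: "bij_betw e {..<n::nat} I"
    using \<open>finite I\<close> by (metis bij_betw_from_nat_into_finite)
  define A' where "A' k = (if k < n then A (e k) else {})" for k
  have inj: "inj_on e {..<n}" and im: "e ` {..<n} = I" using e by (auto simp: bij_betw_def)
  have "range A' \<subseteq> sets M" using assms(3) im by (auto simp: A'_def)
  moreover have "disjoint_family A'"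
    unfolding disjoint_family_on_def
  proof (intro ballI impI)
    fix k l :: nat assume "k \<noteq> l"
    then have "A (e k) \<inter> A (e l) = {}" if "k < n" "l < n"
      using assms(4) inj im that unfolding disjoint_family_on_def inj_on_def by blast
    then show "A' k \<inter> A' l = {}" by (auto simp: A'_def)
  qed
  ultimately have "(\<lambda>k. F (A' k)) sums F (\<Union>k. A' k)"
    using F unfolding vector_measure_def by blast
  moreover have "(\<lambda>k. F (A' k)) sums (\<Sum>k<n. F (A' k))"
    by (intro sums_finite) (auto simp: A'_def vector_measure_empty[OF F])
  ultimately have "F (\<Union>k. A' k) = (\<Sum>k<n. F (A' k))" by (rule sums_unique2)
  also have "\<dots> = (\<Sum>k<n. F (A (e k)))" by (simp add: A'_def)
  also have "\<dots> = (\<Sum>i\<in>I. F (A i))" by (rule sum.reindex_bij_betw[OF e])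
  also have "(\<Union>k. A' k) = (\<Union>i\<in>I. A i)" using im by (auto simp: A'_def split: if_splits)
  finally show ?thesis .
qed

lemma vector_measure_Diff:
  assumes F: "vector_measure M F" and "A \<in> sets M" "B \<in> sets M" "B \<subseteq> A"
  shows "F (A - B) = F A - F B"
proof -
  have "F (\<Union>i\<in>{True, False}. if i then B else A - B) = (\<Sum>i\<in>{True, False}. F (if i then B else A - B))"
    using assms by (intro vector_measure_UN) (auto simp: disjoint_family_on_def)
  moreover have "(\<Union>i\<in>{True, False}. if i then B else A - B) = A" using assms by auto
  ultimately show ?thesis by simp
qed

lemma continuous_wrt_measure_null:
  assumes "continuous_wrt_measure M F" "A \<in> sets M" "measure M A = 0"
  shows "F A = 0"
proof (rule ccontr)
  assume "F A \<noteq> 0"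
  then obtain d where "d > 0" "\<forall>A\<in>sets M. measure M A < d \<longrightarrow> norm (F A) < norm (F A)"
    using assms(1) unfolding continuous_wrt_measure_def by (metis zero_less_norm_iff assms(2,3) order_less_irrefl)
  then show False using assms by auto
qed

text \<open>
  The null set that an exhaustion leaves over does not contribute.
\<close>

lemma (in finite_measure) vector_measure_exhausted:
  assumes F: "vector_measure M F" and null: "\<And>A. A \<in> sets M \<Longrightarrow> measure M A = 0 \<Longrightarrow> F A = 0"
    and "B \<in> sets M" "\<And>n. D n \<in> sets M" "disjoint_family D" "\<And>n. D n \<subseteq> B"
    "measure M (B - (\<Union>n::nat. D n)) = 0"
  shows "(\<lambda>n. F (D n)) sums F B"
proof -
  have "(\<lambda>n. F (D n)) sums F (\<Union>n. D n)"
    using F assms(4,5) unfolding vector_measure_def by blast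
  moreover have "F (B - (\<Union>n. D n)) = 0" using assms by (intro null) auto
  moreover have "F (B - (\<Union>n. D n)) = F B - F (\<Union>n. D n)"
    using assms by (intro vector_measure_Diff) auto
  ultimately show ?thesis by simp
qed

text \<open>
  Otherwise every nonnull piece of \<open>A\<close> would contain a nonnull piece on which \<open>F\<close> is negative;
  exhausting \<open>A\<close> by such pieces would give \<open>F A \<le> 0\<close>.
\<close>

lemma (in finite_measure) Hahn_positive_subset:
  fixes F :: "'a set \<Rightarrow> real"
  assumes F: "vector_measure M F" and null: "\<And>A. A \<in> sets M \<Longrightarrow> measure M A = 0 \<Longrightarrow> F A = 0"
    and A: "A \<in> sets M" "F A > 0"
  shows "\<exists>C\<in>sets M. C \<subseteq> A \<and> measure M C > 0 \<and> (\<forall>B\<in>sets M. B \<subseteq> C \<longrightarrow> F B \<ge> 0)"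
proof (rule ccontr)
  assume neg: "\<not> ?thesis"
  have dense: "\<forall>C\<in>sets M. C \<subseteq> A \<longrightarrow> measure M C > 0 \<longrightarrow>
    (\<exists>B\<in>sets M. B \<subseteq> C \<and> measure M B > 0 \<and> F B < 0)"
  proof (intro ballI impI)
    fix C assume C: "C \<in> sets M" "C \<subseteq> A" "measure M C > 0"
    from neg C obtain B where B: "B \<in> sets M" "B \<subseteq> C" "F B < 0" by (meson not_le)
    then have "measure M B \<noteq> 0" using null[of B] by auto
    with B show "\<exists>B\<in>sets M. B \<subseteq> C \<and> measure M B > 0 \<and> F B < 0"
      using zero_less_measure_iff by blast
  qed
  obtain D :: "nat \<Rightarrow> 'a set" where D: "\<And>n. D n \<in> sets M" "disjoint_family D" "\<And>n. D n \<subseteq> A"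
    "\<And>n. D n = {} \<or> measure M (D n) > 0 \<and> F (D n) < 0"
    "measure M (A - (\<Union>n. D n)) = 0"
    using exhaustion[OF A(1) dense] by (elim exE conjE) (rule that; (erule spec | assumption))
  have sums: "(\<lambda>n. F (D n)) sums F A"
    by (rule vector_measure_exhausted[OF F null A(1) D(1-3,5)])
  have "F (D n) \<le> 0" for n using D(4)[of n] vector_measure_empty[OF F] by (metis less_imp_le order_refl)
  then have "F A \<le> 0" by (rule sums_le[OF _ sums sums_zero])
  with A show False by simp
qed

lemma vector_measure_bounded_linear:
  assumes "vector_measure M F" "bounded_linear T"
  shows "vector_measure M (\<lambda>A. T (F A))"
  unfolding vector_measure_def
proof (intro allI impI)
  fix A :: "nat \<Rightarrow> 'a set" assume "range A \<subseteq> sets M" "disjoint_family A"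
  then have "(\<lambda>n. F (A n)) sums F (\<Union>n. A n)" using assms(1) unfolding vector_measure_def by blast
  then show "(\<lambda>n. T (F (A n))) sums T (F (\<Union>n. A n))" by (rule bounded_linear.sums[OF assms(2)])
qed

lemma (in finite_measure) vector_measure_measure: "vector_measure M (measure M)"
  unfolding vector_measure_def by (auto intro: finite_measure_UNION)

lemma vector_measure_diff:
  assumes "vector_measure M F" "vector_measure M G"
  shows "vector_measure M (\<lambda>A. F A - G A)"
  unfolding vector_measure_def
proof (intro allI impI)
  fix A :: "nat \<Rightarrow> 'a set" assume A: "range A \<subseteq> sets M" "disjoint_family A"
  have "(\<lambda>n. F (A n)) sums F (\<Union>n. A n)" using assms(1) A unfolding vector_measure_def by blast
  moreover have "(\<lambda>n. G (A n)) sums G (\<Union>n. A n)" using assms(2) A unfolding vector_measure_def by blast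
  ultimately show "(\<lambda>n. F (A n) - G (A n)) sums (F (\<Union>n. A n) - G (\<Union>n. A n))"
    by (rule sums_diff)
qed

lemma norm_blinfun_witness:
  fixes z :: "'x::real_normed_vector \<Rightarrow>\<^sub>L real"
  assumes "norm z > c" "c \<ge> 0"
  obtains h where "norm h \<le> 1" "blinfun_apply z h > c"
proof -
  have "\<not> (\<forall>h. norm h \<le> 1 \<longrightarrow> blinfun_apply z h \<le> c)"
  proof
    assume le: "\<forall>h. norm h \<le> 1 \<longrightarrow> blinfun_apply z h \<le> c"
    have "norm (blinfun_apply z x) \<le> c * norm x" for x
    proof (cases "x = 0")
      case False
      have "blinfun_apply z (x /\<^sub>R norm x) \<le> c" "blinfun_apply z (- x /\<^sub>R norm x) \<le> c"
        using le False by auto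
      then show ?thesis using False
        by (simp add: blinfun.scaleR_right blinfun.minus_right field_simps abs_le_iff)
    qed simp
    then have "norm z \<le> c" using assms(2) by (rule norm_blinfun_bound[rotated])
    with assms(1) show False by simp
  qed
  then show ?thesis using that by (auto simp: not_le)
qed

text \<open>
  The functional \<open>F A - (\<nu> A / \<nu> C) F C\<close> is large at some \<open>h\<close>; let \<open>c\<close> be the average of \<open>F(\<cdot>) h\<close>
  over \<open>C\<close>. Then \<open>F(\<cdot>) h\<close> exceeds \<open>(c + \<epsilon>) \<nu>\<close> on \<open>A\<close>, and therefore lies below \<open>c \<nu>\<close> on \<open>C - A\<close>. A
  Hahn decomposition passes from these two sets to subsets on which the inequalities are inherited
  by all measurable subsets. That is what allows the construction to be iterated inside them.
\<close>

lemma (in finite_measure) separating_vector: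
  fixes F :: "'a set \<Rightarrow> 'x::real_normed_vector \<Rightarrow>\<^sub>L real"
  assumes F: "vector_measure M F" and null: "\<And>A. A \<in> sets M \<Longrightarrow> measure M A = 0 \<Longrightarrow> F A = 0"
    and C: "C \<in> sets M" "measure M C > 0" and A: "A \<in> sets M" "A \<subseteq> C" and "\<epsilon> \<ge> 0"
    and far: "norm (F A - (measure M A / measure M C) *\<^sub>R F C) > \<epsilon> * measure M A"
  shows "\<exists>h c C0 C1. norm h \<le> 1 \<and>
    C0 \<in> sets M \<and> C0 \<subseteq> C \<and> measure M C0 > 0 \<and>
      (\<forall>B\<in>sets M. B \<subseteq> C0 \<longrightarrow> (c + \<epsilon>) * measure M B \<le> blinfun_apply (F B) h) \<and>
    C1 \<in> sets M \<and> C1 \<subseteq> C \<and> measure M C1 > 0 \<and>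
      (\<forall>B\<in>sets M. B \<subseteq> C1 \<longrightarrow> blinfun_apply (F B) h \<le> c * measure M B)"
proof -
  have "\<epsilon> * measure M A \<ge> 0" using \<open>\<epsilon> \<ge> 0\<close> by simp
  then obtain h where h: "norm h \<le> 1" 
    "blinfun_apply (F A - (measure M A / measure M C) *\<^sub>R F C) h > \<epsilon> * measure M A"
    by (rule norm_blinfun_witness[OF far])
  define c where "c = blinfun_apply (F C) h / measure M C"
  have Fh: "vector_measure M (\<lambda>A. blinfun_apply (F A) h)"
    by (rule vector_measure_bounded_linear[OF F blinfun.bounded_linear_left])
  have lin: "vector_measure M (\<lambda>A. d * measure M A)" for d
    by (rule vector_measure_bounded_linear[OF vector_measure_measure bounded_linear_mult_right])
  have gtA: "blinfun_apply (F A) h > (c + \<epsilon>) * measure M A"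
    using h(2) by (simp add: c_def blinfun.diff_left blinfun.scaleR_left field_simps)
  have "\<exists>C0\<in>sets M. C0 \<subseteq> A \<and> measure M C0 > 0 \<and> (\<forall>B\<in>sets M. B \<subseteq> C0 \<longrightarrow>
      blinfun_apply (F B) h - (c + \<epsilon>) * measure M B \<ge> 0)"
    using A gtA null by (intro Hahn_positive_subset vector_measure_diff Fh lin) auto
  then obtain C0 where C0: "C0 \<in> sets M" "C0 \<subseteq> A" "measure M C0 > 0"
    "\<And>B. B \<in> sets M \<Longrightarrow> B \<subseteq> C0 \<Longrightarrow> blinfun_apply (F B) h - (c + \<epsilon>) * measure M B \<ge> 0" by blast
  have "c * measure M (C - A) > blinfun_apply (F (C - A)) h"
  proof -
    have "measure M A > 0" using gtA null[of A] A(1) by (cases "measure M A = 0") (auto simp: zero_less_measure_iff)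
    have "blinfun_apply (F (C - A)) h = blinfun_apply (F C) h - blinfun_apply (F A) h"
      using C A by (intro vector_measure_Diff[OF Fh]) auto
    also have "blinfun_apply (F C) h = c * measure M C" using C by (simp add: c_def)
    also have "c * measure M C - blinfun_apply (F A) h < c * measure M C - c * measure M A"
      using gtA \<open>\<epsilon> * measure M A \<ge> 0\<close> by (simp add: algebra_simps)
    also have "\<dots> = c * measure M (C - A)"
      using C A by (simp add: finite_measure_Diff algebra_simps)
    finally show ?thesis .
  qed
  then have "\<exists>C1\<in>sets M. C1 \<subseteq> C - A \<and> measure M C1 > 0 \<and> (\<forall>B\<in>sets M. B \<subseteq> C1 \<longrightarrow>
      c * measure M B - blinfun_apply (F B) h \<ge> 0)"
    using A C null by (intro Hahn_positive_subset vector_measure_diff Fh lin) auto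
  then obtain C1 where C1: "C1 \<in> sets M" "C1 \<subseteq> C - A" "measure M C1 > 0"
    "\<And>B. B \<in> sets M \<Longrightarrow> B \<subseteq> C1 \<Longrightarrow> c * measure M B - blinfun_apply (F B) h \<ge> 0" by blast
  show ?thesis
    using h(1) C0 C1 A by (intro exI[of _ h] exI[of _ c] exI[of _ C0] exI[of _ C1]) auto
qed

text \<open>
  Bounded variation speaks of partitions of the whole space, which consist of nonempty sets. Here
  the family is arbitrary: empty members are dropped, and the complement of the union is added if
  it is nonempty.
\<close>

lemma bounded_variation_disjoint_family:
  assumes F: "vector_measure M F" and bv: "bounded_variation M F"
  shows "\<exists>V. \<forall>(D :: 'i \<Rightarrow> 'a set) I. finite I \<longrightarrow> D ` I \<subseteq> sets M \<longrightarrow>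
    disjoint_family_on D I \<longrightarrow> (\<Sum>i\<in>I. norm (F (D i))) \<le> V"
proof -
  from bv obtain V where V: "\<And>P. finite P \<Longrightarrow> P \<subseteq> sets M \<Longrightarrow> partition_on (space M) P \<Longrightarrow>
      (\<Sum>A\<in>P. norm (F A)) \<le> V"
    unfolding bounded_variation_def by blast
  show ?thesis
  proof (intro exI[of _ V] allI impI)
    fix D :: "'i \<Rightarrow> 'a set" and I
    assume "finite I" "D ` I \<subseteq> sets M" "disjoint_family_on D I"
    then have I: "finite I" "\<And>i. i \<in> I \<Longrightarrow> D i \<in> sets M" "disjoint_family_on D I" by auto
    define J where "J = {i\<in>I. D i \<noteq> {}}"
    define R where "R = space M - (\<Union>i\<in>I. D i)"
    define P where "P = D ` J \<union> ({R} - {{}})"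
    have sub: "D i \<subseteq> space M" if "i \<in> I" for i using I(2)[OF that] by (rule sets.sets_into_space)
    have disj: "D i \<inter> D j = {}" if "i \<in> I" "j \<in> I" "i \<noteq> j" for i j
      using I(3) that unfolding disjoint_family_on_def by blast
    have inj: "inj_on D J"
      using disj unfolding J_def inj_on_def by (metis (mono_tags, lifting) Int_absorb mem_Collect_eq)
    have "\<Union>P = (\<Union>i\<in>J. D i) \<union> R" by (auto simp: P_def)
    also have "(\<Union>i\<in>J. D i) = (\<Union>i\<in>I. D i)" by (auto simp: J_def)
    also have "\<dots> \<union> R = space M" unfolding R_def using sub by blast
    finally have "\<Union>P = space M" .
    moreover have "disjoint P"
    proof (rule disjointI)
      fix X Y assume "X \<in> P" "Y \<in> P" "X \<noteq> Y"
      then consider i j where "i \<in> I" "j \<in> I" "X = D i" "Y = D j" "i \<noteq> j"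
        | i where "i \<in> I" "X = D i" "Y = R" | i where "i \<in> I" "X = R" "Y = D i"
        unfolding P_def J_def by auto
      then show "X \<inter> Y = {}" by cases (use disj in \<open>auto simp: R_def\<close>)
    qed
    moreover have "{} \<notin> P" unfolding P_def J_def by auto
    ultimately have "partition_on (space M) P" by (simp add: partition_on_def)
    moreover have "R \<in> sets M" unfolding R_def using I by (intro sets.Diff sets.finite_UN) auto
    then have "P \<subseteq> sets M" "finite P" using I by (auto simp: P_def J_def)
    ultimately have "(\<Sum>A\<in>P. norm (F A)) \<le> V" by (intro V)
    moreover have "(\<Sum>A\<in>D ` J. norm (F A)) \<le> (\<Sum>A\<in>P. norm (F A))"
      using \<open>finite P\<close> by (intro sum_mono2) (auto simp: P_def)
    moreover have "(\<Sum>A\<in>D ` J. norm (F A)) = (\<Sum>i\<in>J. norm (F (D i)))"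
      using inj by (simp add: sum.reindex)
    moreover have "(\<Sum>i\<in>J. norm (F (D i))) = (\<Sum>i\<in>I. norm (F (D i)))"
      using I(1) vector_measure_empty[OF F] by (intro sum.mono_neutral_left) (auto simp: J_def)
    ultimately show "(\<Sum>i\<in>I. norm (F (D i))) \<le> V" by simp
  qed
qed

text \<open>
  If every nonnull piece of \<open>B\<close> contained some \<open>A\<close> with \<open>norm (F A) > L * \<nu> A\<close>, exhausting \<open>B\<close> by
  such sets would make the variation of \<open>F\<close> at least \<open>L * \<nu> B\<close>, which is false for \<open>L = (V + 1) /
  \<nu> B\<close> when \<open>V\<close> bounds the variation.
\<close>

lemma (in finite_measure) bounded_density_subset:
  assumes F: "vector_measure M F" and null: "\<And>A. A \<in> sets M \<Longrightarrow> measure M A = 0 \<Longrightarrow> F A = 0"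
    and bv: "bounded_variation M F" and B: "B \<in> sets M" "measure M B > 0"
  shows "\<exists>C\<in>sets M. \<exists>L>0. C \<subseteq> B \<and> measure M C > 0 \<and>
    (\<forall>A\<in>sets M. A \<subseteq> C \<longrightarrow> norm (F A) \<le> L * measure M A)"
proof (rule ccontr)
  assume neg: "\<not> ?thesis"
  obtain V where V: "\<And>(D :: nat \<Rightarrow> 'a set) I. finite I \<Longrightarrow> (\<And>i. i \<in> I \<Longrightarrow> D i \<in> sets M) \<Longrightarrow>
    disjoint_family_on D I \<Longrightarrow> (\<Sum>i\<in>I. norm (F (D i))) \<le> V"
    using bounded_variation_disjoint_family[OF F bv] by (metis image_subset_iff)
  have "V \<ge> 0" using V[of "{}"] by (simp add: disjoint_family_on_def)
  define L where "L = (V + 1) / measure M B"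
  have "L > 0" using \<open>V \<ge> 0\<close> B by (simp add: L_def)
  have dense: "\<forall>C\<in>sets M. C \<subseteq> B \<longrightarrow> measure M C > 0 \<longrightarrow>
    (\<exists>A\<in>sets M. A \<subseteq> C \<and> measure M A > 0 \<and> norm (F A) > L * measure M A)"
  proof (intro ballI impI)
    fix C assume C: "C \<in> sets M" "C \<subseteq> B" "measure M C > 0"
    from neg C \<open>L > 0\<close> obtain A where A: "A \<in> sets M" "A \<subseteq> C" "norm (F A) > L * measure M A"
      by (meson not_le)
    then have "measure M A \<noteq> 0" using null[of A] by auto
    with A show "\<exists>A\<in>sets M. A \<subseteq> C \<and> measure M A > 0 \<and> norm (F A) > L * measure M A"
      using zero_less_measure_iff by blast
  qed
  obtain D :: "nat \<Rightarrow> 'a set" where D: "\<And>n. D n \<in> sets M" "disjoint_family D" "\<And>n. D n \<subseteq> B"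
    "\<And>n. D n = {} \<or> measure M (D n) > 0 \<and> norm (F (D n)) > L * measure M (D n)"
    "measure M (B - (\<Union>n. D n)) = 0"
    using exhaustion[OF B(1) dense] by (elim exE conjE) (rule that; (erule spec | assumption))
  have "(\<lambda>n. measure M (D n)) sums measure M B"
    by (rule vector_measure_exhausted[OF vector_measure_measure _ B(1) D(1-3,5)])
  then have "(\<lambda>n. L * measure M (D n)) sums (L * measure M B)" by (rule sums_mult)
  moreover have "(\<Sum>i<n. L * measure M (D i)) \<le> V" for n
  proof -
    have "L * measure M (D i) \<le> norm (F (D i))" for i using D(4)[of i] by auto
    then have "(\<Sum>i<n. L * measure M (D i)) \<le> (\<Sum>i<n. norm (F (D i)))" by (intro sum_mono)
    also have "\<dots> \<le> V" using D by (intro V) (auto simp: disjoint_family_on_def)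
    finally show ?thesis .
  qed
  ultimately have "L * measure M B \<le> V"
    unfolding sums_def by (intro LIMSEQ_le_const2) auto
  then show False using B by (simp add: L_def)
qed

section \<open>Strong measurability\<close>

lemma borel_measurable_completion_AE_limit:
  fixes f :: "'a \<Rightarrow> real"
  assumes s: "\<And>n. s n \<in> borel_measurable (completion M)" and lim: "AE x in M. (\<lambda>n. s n x) \<longlonglongrightarrow> f x"
  shows "f \<in> borel_measurable (completion M)"
proof -
  have m: "(\<lambda>x. lim (\<lambda>n. s n x)) \<in> borel_measurable (completion M)"
    using s by measurable
  have eq: "AE x in completion M. lim (\<lambda>n. s n x) = f x"
    using AE_completion[OF lim] by eventually_elim (rule limI)
  show ?thesis
  proof (rule measurableI)
    fix B :: "real set" assume B: "B \<in> sets borel"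
    show "f -` B \<inter> space (completion M) \<in> sets (completion M)"
    proof (rule completion.in_sets_AE)
      show "(\<lambda>x. lim (\<lambda>n. s n x)) -` B \<inter> space (completion M) \<in> sets (completion M)"
        using m B by (rule measurable_sets)
      show "AE x in completion M. x \<in> (\<lambda>x. lim (\<lambda>n. s n x)) -` B \<inter> space (completion M)
          \<longleftrightarrow> x \<in> f -` B \<inter> space (completion M)"
        using eq by eventually_elim auto
    qed auto
  qed auto
qed

lemma strongly_measurable_simple: "simple_function M f \<Longrightarrow> strongly_measurable M f"
  unfolding strongly_measurable_def by (intro exI[of _ "\<lambda>_. f"]) auto

text \<open>
  Simple functions can be combined by any operation whatever the range is. Borel measurability, by
  contrast, may be lost already under addition when the range is not separable.
\<close>

lemma strongly_measurable_compose2: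
  assumes f: "strongly_measurable M f" and g: "strongly_measurable M g"
    and h: "continuous_on UNIV (\<lambda>p. h (fst p) (snd p))"
  shows "strongly_measurable M (\<lambda>x. h (f x) (g x))"
proof -
  from f obtain s where s: "\<And>n. simple_function M (s n)" "AE x in M. (\<lambda>n. s n x) \<longlonglongrightarrow> f x"
    unfolding strongly_measurable_def by blast
  from g obtain t where t: "\<And>n. simple_function M (t n)" "AE x in M. (\<lambda>n. t n x) \<longlonglongrightarrow> g x"
    unfolding strongly_measurable_def by blast
  have "AE x in M. (\<lambda>n. h (s n x) (t n x)) \<longlonglongrightarrow> h (f x) (g x)"
    using s(2) t(2)
  proof eventually_elim
    fix x assume "(\<lambda>n. s n x) \<longlonglongrightarrow> f x" "(\<lambda>n. t n x) \<longlonglongrightarrow> g x"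
    then have "(\<lambda>n. (s n x, t n x)) \<longlonglongrightarrow> (f x, g x)" by (rule tendsto_Pair)
    then show "(\<lambda>n. h (s n x) (t n x)) \<longlonglongrightarrow> h (f x) (g x)"
      using continuous_on_tendsto_compose[OF h, of "\<lambda>n. (s n x, t n x)" "(f x, g x)"] by simp
  qed
  moreover have "simple_function M (\<lambda>x. h (s n x) (t n x))" for n
    using s(1) t(1) by (rule simple_function_compose2)
  ultimately show ?thesis
    unfolding strongly_measurable_def by (intro exI[of _ "\<lambda>n x. h (s n x) (t n x)"]) blast
qed

lemma strongly_measurable_add:
  "strongly_measurable M f \<Longrightarrow> strongly_measurable M g \<Longrightarrow> strongly_measurable M (\<lambda>x. f x + g x)"
  by (rule strongly_measurable_compose2) (auto intro!: continuous_intros)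

lemma strongly_measurable_scaleR:
  "strongly_measurable M f \<Longrightarrow> strongly_measurable M (\<lambda>x. c *\<^sub>R f x)"
  by (rule strongly_measurable_compose2[where h = "\<lambda>y _. c *\<^sub>R y" and g = f])
    (auto intro!: continuous_intros)

lemma strongly_measurable_real:
  fixes f :: "'a \<Rightarrow> real"
  assumes "strongly_measurable M f"
  shows "f \<in> borel_measurable (completion M)"
proof -
  from assms obtain s where s: "\<And>n. simple_function M (s n)" "AE x in M. (\<lambda>n. s n x) \<longlonglongrightarrow> f x"
    unfolding strongly_measurable_def by blast
  show ?thesis
    by (rule borel_measurable_completion_AE_limit[OF _ s(2)])
      (intro measurable_completion borel_measurable_simple_function s(1))
qed

lemma strongly_measurable_norm_diff:
  assumes "strongly_measurable M f" "strongly_measurable M g"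
  shows "(\<lambda>x. norm (f x - g x)) \<in> borel_measurable (completion M)"
  by (intro strongly_measurable_real strongly_measurable_compose2[OF assms, where h = "\<lambda>y z. norm (y - z)"])
    (auto intro!: continuous_intros)

lemma strongly_measurable_norm:
  assumes "strongly_measurable M f"
  shows "(\<lambda>x. norm (f x)) \<in> borel_measurable (completion M)"
  by (intro strongly_measurable_real strongly_measurable_compose2[OF assms assms, where h = "\<lambda>y _. norm y"])
    (auto intro!: continuous_intros)

lemma strongly_measurable_blinfun_apply:
  fixes g :: "'a \<Rightarrow> 'x::real_normed_vector \<Rightarrow>\<^sub>L real"
  assumes "strongly_measurable M g" "strongly_measurable M f"
  shows "(\<lambda>x. blinfun_apply (g x) (f x)) \<in> borel_measurable (completion M)"
  by (intro strongly_measurable_real strongly_measurable_compose2[OF assms, where h = blinfun_apply])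
    (auto intro!: continuous_intros)

section \<open>Densities of vector measures\<close>

lemma (in finite_measure) simple_bochner_integrable:
  "simple_function M f \<Longrightarrow> Bochner_Integration.simple_bochner_integrable M f"
  by (intro Bochner_Integration.simple_bochner_integrable.intros) auto

lemma simple_function_indicator_scaleR:
  "A \<in> sets M \<Longrightarrow> simple_function M (\<lambda>x. indicat_real A x *\<^sub>R z)"
  by (rule simple_function_compose1[where g = "\<lambda>r. r *\<^sub>R z"]) simp

lemma (in finite_measure) simple_bochner_integral_step:
  fixes z :: "'i \<Rightarrow> 'z::real_normed_vector"
  assumes "finite I" "\<And>i. i \<in> I \<Longrightarrow> A i \<in> sets M"
  shows "Bochner_Integration.simple_bochner_integral M (\<lambda>x. \<Sum>i\<in>I. indicator (A i) x *\<^sub>R z i)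
    = (\<Sum>i\<in>I. measure M (A i) *\<^sub>R z i)"
  using assms
proof (induction I rule: finite_induct)
  case empty
  then show ?case by (auto simp: simple_bochner_integral_def intro!: sum.neutral)
next
  case (insert j I)
  have s: "simple_function M (\<lambda>x. indicat_real (A i) x *\<^sub>R z i)" if "i \<in> insert j I" for i
    using insert.prems[OF that] by (rule simple_function_indicator_scaleR)
  have "Bochner_Integration.simple_bochner_integral M (\<lambda>x. indicat_real (A j) x *\<^sub>R z j)
      = Bochner_Integration.simple_bochner_integral M (indicat_real (A j)) *\<^sub>R z j"
    using insert.prems by (intro simple_bochner_integral_linear[where f = "\<lambda>r. r *\<^sub>R z j"])
      (auto intro!: simple_bochner_integrable simp: linear_iff scaleR_add_left)
  also have "Bochner_Integration.simple_bochner_integral M (indicat_real (A j)) = measure M (A j)"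
  proof -
    have "ennreal (Bochner_Integration.simple_bochner_integral M (indicat_real (A j))) = (\<integral>\<^sup>+x. indicat_real (A j) x \<partial>M)"
      using insert.prems by (intro simple_bochner_integral_eq_nn_integral simple_bochner_integrable) auto
    also have "\<dots> = ennreal (measure M (A j))"
      using insert.prems by (simp add: ennreal_indicator emeasure_eq_measure)
    finally show ?thesis by (simp add: simple_bochner_integral_nonneg)
  qed
  finally have "Bochner_Integration.simple_bochner_integral M (\<lambda>x. indicat_real (A j) x *\<^sub>R z j)
      = measure M (A j) *\<^sub>R z j" .
  moreover have "Bochner_Integration.simple_bochner_integral M
        (\<lambda>x. indicat_real (A j) x *\<^sub>R z j + (\<Sum>i\<in>I. indicat_real (A i) x *\<^sub>R z i))
      = Bochner_Integration.simple_bochner_integral M (\<lambda>x. indicat_real (A j) x *\<^sub>R z j)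
      + Bochner_Integration.simple_bochner_integral M (\<lambda>x. \<Sum>i\<in>I. indicat_real (A i) x *\<^sub>R z i)"
    by (intro simple_bochner_integral_add simple_bochner_integrable simple_function_sum s) auto
  moreover have "Bochner_Integration.simple_bochner_integral M (\<lambda>x. \<Sum>i\<in>I. indicat_real (A i) x *\<^sub>R z i)
      = (\<Sum>i\<in>I. measure M (A i) *\<^sub>R z i)"
    using insert by blast
  ultimately show ?case by (simp only: sum.insert[OF insert.hyps])
qed

lemma (in finite_measure) small_oscillation_partition:
  assumes F: "vector_measure M F" and "\<epsilon> > 0" "\<delta> > 0"
    and dense: "\<forall>B\<in>sets M. B \<subseteq> space M \<longrightarrow> measure M B > 0 \<longrightarrow> (\<exists>C\<in>sets M. C \<subseteq> B \<and> measure M C > 0 \<and>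
      (\<forall>A\<in>sets M. A \<subseteq> C \<longrightarrow> norm (F A - (measure M A / measure M C) *\<^sub>R F C) \<le> \<epsilon> * measure M A))"
  shows "\<exists>(D :: nat \<Rightarrow> 'a set) K. (\<forall>i. D i \<in> sets M) \<and> disjoint_family D \<and>
    (\<forall>i. \<forall>A\<in>sets M. A \<subseteq> D i \<longrightarrow>
      norm (F A - (measure M A / measure M (D i)) *\<^sub>R F (D i)) \<le> \<epsilon> * measure M A) \<and>
    measure M (space M - (\<Union>i<K. D i)) < \<delta>"
proof -
  obtain D :: "nat \<Rightarrow> 'a set" where D: "\<And>n. D n \<in> sets M" "disjoint_family D" 
    "\<And>n. D n = {} \<or> measure M (D n) > 0 \<and>
      (\<forall>A\<in>sets M. A \<subseteq> D n \<longrightarrow> norm (F A - (measure M A / measure M (D n)) *\<^sub>R F (D n)) \<le> \<epsilon> * measure M A)"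
    "measure M (space M - (\<Union>n. D n)) = 0"
    using exhaustion[OF sets.top dense] by (elim exE conjE) (rule that; (erule spec | assumption))
  have "(\<lambda>K. measure M (space M - (\<Union>i<K. D i))) \<longlonglongrightarrow> measure M (\<Inter>K. space M - (\<Union>i<K. D i))"
    using D by (intro finite_Lim_measure_decseq) (auto simp: decseq_def intro: less_le_trans)
  also have "(\<Inter>K. space M - (\<Union>i<K. D i)) = space M - (\<Union>n. D n)" by auto
  finally have "\<forall>\<^sub>F K in sequentially. measure M (space M - (\<Union>i<K. D i)) < \<delta>"
    using D(4) \<open>\<delta> > 0\<close> by (simp add: order_tendstoD)
  then obtain K where "measure M (space M - (\<Union>i<K. D i)) < \<delta>"
    by (auto simp: eventually_sequentially)
  moreover have "norm (F A - (measure M A / measure M (D i)) *\<^sub>R F (D i)) \<le> \<epsilon> * measure M A"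
    if "A \<in> sets M" "A \<subseteq> D i" for A i
    using D(3)[of i] that vector_measure_empty[OF F] by auto
  ultimately show ?thesis using D(1,2) by (intro exI[of _ D] exI[of _ K]) blast
qed

text \<open>
  For \<open>\<epsilon>\<^sub>n = 2\<^sup>-\<^sup>n\<close> let \<open>s\<^sub>n\<close> be the step function formed by the averages of \<open>F\<close> over finitely
  many disjoint sets of oscillation at most \<open>\<epsilon>\<^sub>n\<close>, whose union \<open>U\<^sub>n\<close> misses only a set of measure
  less than \<open>\<epsilon>\<^sub>n\<close>, so small moreover that \<open>F\<close> is below \<open>\<epsilon>\<^sub>n\<close> in norm on its subsets. Then the
  integral of \<open>s\<^sub>n\<close> over \<open>A\<close> tends to \<open>F A\<close>. Where a piece for \<open>n\<close> meets a piece for \<open>m\<close> in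
  positive measure, the two averages differ by at most \<open>\<epsilon>\<^sub>n + \<epsilon>\<^sub>m\<close>, because both are close to the
  average over the intersection. By the Borel-Cantelli lemma almost every point lies in \<open>U\<^sub>n\<close> for
  all large \<open>n\<close>, so \<open>s\<^sub>n\<close> converges almost everywhere to some \<open>g\<close>. Bounded variation bounds the
  integrals of \<open>norm s\<^sub>n\<close>, so Fatou's lemma makes \<open>g\<close> integrable, and \<open>s\<^sub>n\<close> then converges to \<open>g\<close>
  in mean by dominated convergence.
\<close>

lemma (in finite_measure) density_of_small_oscillation:
  fixes F :: "'a set \<Rightarrow> 'z::banach"
  assumes F: "vector_measure M F" and ac: "continuous_wrt_measure M F" and bv: "bounded_variation M F"
    and dense: "\<And>\<epsilon>. \<epsilon> > 0 \<Longrightarrow> \<forall>B\<in>sets M. B \<subseteq> space M \<longrightarrow> measure M B > 0 \<longrightarrow>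
      (\<exists>C\<in>sets M. C \<subseteq> B \<and> measure M C > 0 \<and>
      (\<forall>A\<in>sets M. A \<subseteq> C \<longrightarrow> norm (F A - (measure M A / measure M C) *\<^sub>R F C) \<le> \<epsilon> * measure M A))"
  shows "\<exists>g. \<forall>A\<in>sets M. has_strong_bochner_integral M (\<lambda>x. indicator A x *\<^sub>R g x) (F A)"
proof -
  obtain V where V: "\<And>(D :: nat \<Rightarrow> 'a set) I. finite I \<Longrightarrow> (\<And>i. i \<in> I \<Longrightarrow> D i \<in> sets M) \<Longrightarrow>
    disjoint_family_on D I \<Longrightarrow> (\<Sum>i\<in>I. norm (F (D i))) \<le> V"
    using bounded_variation_disjoint_family[OF F bv] by (metis image_subset_iff)
  define \<epsilon> :: "nat \<Rightarrow> real" where "\<epsilon> n = (1 / 2) ^ n" for n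
  have \<epsilon>: "\<epsilon> n > 0" "\<epsilon> n \<le> 1" for n by (auto simp: \<epsilon>_def power_le_one)
  have \<epsilon>0: "\<epsilon> \<longlonglongrightarrow> 0" unfolding \<epsilon>_def[abs_def] by (rule LIMSEQ_power_zero) simp
  have "\<exists>d>0. \<forall>A\<in>sets M. measure M A < d \<longrightarrow> norm (F A) < \<epsilon> n" for n
    using ac \<epsilon>(1) unfolding continuous_wrt_measure_def by blast
  then obtain d where d: "\<And>n. d n > 0"
    "\<And>n A. A \<in> sets M \<Longrightarrow> measure M A < d n \<Longrightarrow> norm (F A) < \<epsilon> n" by metis
  have "\<exists>(D :: nat \<Rightarrow> 'a set) K. (\<forall>i. D i \<in> sets M) \<and> disjoint_family D \<and>
    (\<forall>i. \<forall>A\<in>sets M. A \<subseteq> D i \<longrightarrow>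
      norm (F A - (measure M A / measure M (D i)) *\<^sub>R F (D i)) \<le> \<epsilon> n * measure M A) \<and>
    measure M (space M - (\<Union>i<K. D i)) < min (\<epsilon> n) (d n)" for n
    using \<epsilon>(1) d(1) by (intro small_oscillation_partition F dense) auto
  then obtain D :: "nat \<Rightarrow> nat \<Rightarrow> 'a set" and K where D: "\<And>n i. D n i \<in> sets M" "\<And>n. disjoint_family (D n)"
    "\<And>n i A. A \<in> sets M \<Longrightarrow> A \<subseteq> D n i \<Longrightarrow>
      norm (F A - (measure M A / measure M (D n i)) *\<^sub>R F (D n i)) \<le> \<epsilon> n * measure M A"
    "\<And>n. measure M (space M - (\<Union>i<K n. D n i)) < min (\<epsilon> n) (d n)"
    by metis
  define U where "U n = (\<Union>i<K n. D n i)" for n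
  define z where "z n i = (1 / measure M (D n i)) *\<^sub>R F (D n i)" for n i
  define s where "s n x = (\<Sum>i<K n. indicat_real (D n i) x *\<^sub>R z n i)" for n x
  have U: "U n \<in> sets M" for n unfolding U_def using D(1) by auto
  have osc: "norm (F A - measure M A *\<^sub>R z n i) \<le> \<epsilon> n * measure M A" if "A \<in> sets M" "A \<subseteq> D n i" for n i A
    using D(3)[OF that] by (simp add: z_def)
  have Dj: "i = j" if "x \<in> D n i" "x \<in> D n j" for n i j x
    using D(2)[of n] that unfolding disjoint_family_on_def by blast
  have s_in: "s n x = z n i" if "x \<in> D n i" "i < K n" for n i x
  proof -
    have "s n x = (\<Sum>j<K n. if j = i then z n i else 0)"
      unfolding s_def using that Dj by (intro sum.cong) (auto simp: indicator_def)
    with that show ?thesis by simp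
  qed
  have s_out: "s n x = 0" if "x \<notin> U n" for n x
    using that unfolding s_def U_def by (intro sum.neutral) auto
  have s_simple: "simple_function M (s n)" for n
    unfolding s_def[abs_def] using D(1)
    by (intro simple_function_sum simple_function_indicator_scaleR) auto
  have z_close: "norm (z n i - z m j) \<le> \<epsilon> n + \<epsilon> m" if pos: "measure M (D n i \<inter> D m j) \<noteq> 0" for n m i j
  proof -
    let ?A = "D n i \<inter> D m j"
    have p: "measure M ?A > 0" using pos by (simp add: zero_less_measure_iff)
    have "norm (F ?A - measure M ?A *\<^sub>R z n i) \<le> \<epsilon> n * measure M ?A"
      "norm (F ?A - measure M ?A *\<^sub>R z m j) \<le> \<epsilon> m * measure M ?A"
      using D(1) by (auto intro!: osc)
    then have "norm ((F ?A - measure M ?A *\<^sub>R z m j) - (F ?A - measure M ?A *\<^sub>R z n i))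
        \<le> (\<epsilon> n + \<epsilon> m) * measure M ?A"
      by (intro order_trans[OF norm_triangle_ineq4]) (simp add: algebra_simps)
    also have "(F ?A - measure M ?A *\<^sub>R z m j) - (F ?A - measure M ?A *\<^sub>R z n i)
        = measure M ?A *\<^sub>R (z n i - z m j)" by (simp add: algebra_simps)
    finally show ?thesis using p by simp
  qed
  have "AE x in M. \<forall>n m i j. measure M (D n i \<inter> D m j) = 0 \<longrightarrow> x \<notin> D n i \<inter> D m j"
    unfolding AE_all_countable
  proof (intro allI)
    fix n m i j
    show "AE x in M. measure M (D n i \<inter> D m j) = 0 \<longrightarrow> x \<notin> D n i \<inter> D m j"
    proof (cases "measure M (D n i \<inter> D m j) = 0")
      case True
      then have "D n i \<inter> D m j \<in> null_sets M"
        using D(1) by (intro null_setsI) (auto simp: emeasure_eq_measure)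
      from AE_not_in[OF this] show ?thesis by eventually_elim simp
    qed simp
  qed
  moreover have "AE x in M. \<forall>\<^sub>F n in sequentially. x \<in> space M - (space M - U n)"
  proof (rule borel_cantelli_AE1)
    show "summable (\<lambda>n. measure M (space M - U n))"
    proof (rule summable_comparison_test')
      show "summable \<epsilon>" unfolding \<epsilon>_def[abs_def] by (rule summable_geometric) simp
      show "norm (measure M (space M - U n)) \<le> \<epsilon> n" for n using D(4)[of n] by (simp add: U_def)
    qed
  qed (use U in \<open>auto simp: less_top[symmetric]\<close>)
  ultimately have good: "AE x in M. (\<forall>n m. x \<in> U n \<longrightarrow> x \<in> U m \<longrightarrow> norm (s n x - s m x) \<le> \<epsilon> n + \<epsilon> m) \<and>
      (\<forall>\<^sub>F n in sequentially. x \<in> U n)"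
  proof eventually_elim
    case (elim x)
    have "norm (s n x - s m x) \<le> \<epsilon> n + \<epsilon> m" if x: "x \<in> U n" "x \<in> U m" for n m
    proof -
      obtain i j where ij: "i < K n" "x \<in> D n i" "j < K m" "x \<in> D m j" using x unfolding U_def by auto
      then have "measure M (D n i \<inter> D m j) \<noteq> 0" using elim(1) by blast
      then show ?thesis using z_close s_in ij by simp
    qed
    moreover have "\<forall>\<^sub>F n in sequentially. x \<in> U n"
      using elim(2) by eventually_elim auto
    ultimately show ?case by blast
  qed
  define g where "g x = lim (\<lambda>n. s n x)" for x
  have lim: "AE x in M. (\<lambda>n. s n x) \<longlonglongrightarrow> g x \<and> (\<forall>\<^sub>F n in sequentially. x \<in> U n) \<and>
      (\<forall>n. x \<in> U n \<longrightarrow> norm (g x - s n x) \<le> \<epsilon> n)"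
    using good
  proof eventually_elim
    case (elim x)
    then obtain N where N: "\<And>n. n \<ge> N \<Longrightarrow> x \<in> U n" by (auto simp: eventually_sequentially)
    have "Cauchy (\<lambda>n. s n x)"
    proof (rule CauchyI)
      fix e :: real assume "e > 0"
      then have "\<forall>\<^sub>F n in sequentially. \<epsilon> n < e / 2" using \<epsilon>0 by (intro order_tendstoD) auto
      then obtain N' where N': "\<And>n. n \<ge> N' \<Longrightarrow> \<epsilon> n < e / 2" by (auto simp: eventually_sequentially)
      show "\<exists>M. \<forall>m\<ge>M. \<forall>n\<ge>M. norm (s m x - s n x) < e"
      proof (intro exI[of _ "max N N'"] allI impI)
        fix m n assume "m \<ge> max N N'" "n \<ge> max N N'"
        then have "x \<in> U m" "x \<in> U n" "\<epsilon> m < e / 2" "\<epsilon> n < e / 2" using N N' by auto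
        moreover from this(1,2) have "norm (s m x - s n x) \<le> \<epsilon> m + \<epsilon> n" using elim by blast
        ultimately show "norm (s m x - s n x) < e" by linarith
      qed
    qed
    then have l: "(\<lambda>n. s n x) \<longlonglongrightarrow> g x"
      unfolding g_def by (simp add: Cauchy_convergent_iff convergent_LIMSEQ_iff)
    have "norm (g x - s n x) \<le> \<epsilon> n" if "x \<in> U n" for n
    proof (rule LIMSEQ_le[of "\<lambda>m. norm (s m x - s n x)" _ "\<lambda>m. \<epsilon> m + \<epsilon> n"])
      show "(\<lambda>m. norm (s m x - s n x)) \<longlonglongrightarrow> norm (g x - s n x)" by (intro tendsto_intros l)
      show "(\<lambda>m. \<epsilon> m + \<epsilon> n) \<longlonglongrightarrow> \<epsilon> n" using tendsto_add[OF \<epsilon>0 tendsto_const[of "\<epsilon> n"]] by simp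
      show "\<exists>N. \<forall>m\<ge>N. norm (s m x - s n x) \<le> \<epsilon> m + \<epsilon> n" using elim N that by blast
    qed
    with l elim show ?case by blast
  qed
  have g_sm: "strongly_measurable M g"
    unfolding strongly_measurable_def
  proof (intro exI[of _ s] conjI allI)
    show "AE x in M. (\<lambda>n. s n x) \<longlonglongrightarrow> g x" using lim by eventually_elim blast
  qed (rule s_simple)
  have g_meas: "(\<lambda>x. norm (g x)) \<in> borel_measurable (completion M)"
    using g_sm by (rule strongly_measurable_norm)
  have s_int: "(\<integral>\<^sup>+x. norm (s n x) \<partial>completion M) \<le> ennreal V" for n
  proof -
    have "(\<integral>\<^sup>+x. norm (s n x) \<partial>completion M) = (\<integral>\<^sup>+x. norm (s n x) \<partial>M)"
      by (rule nn_integral_completion)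
    also have "\<dots> \<le> (\<integral>\<^sup>+x. (\<Sum>i<K n. ennreal (norm (z n i)) * indicator (D n i) x) \<partial>M)"
    proof (rule nn_integral_mono)
      fix x
      have "norm (s n x) \<le> (\<Sum>i<K n. norm (z n i) * indicator (D n i) x)"
        unfolding s_def by (intro order_trans[OF norm_sum] sum_mono) (auto simp: indicator_def)
      then have "ennreal (norm (s n x)) \<le> ennreal (\<Sum>i<K n. norm (z n i) * indicator (D n i) x)"
        by (rule ennreal_leI)
      also have "\<dots> = (\<Sum>i<K n. ennreal (norm (z n i)) * indicator (D n i) x)"
        by (subst sum_ennreal[symmetric]) (auto simp: ennreal_mult ennreal_indicator)
      finally show "ennreal (norm (s n x)) \<le> (\<Sum>i<K n. ennreal (norm (z n i)) * indicator (D n i) x)" .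
    qed
    also have "\<dots> = (\<Sum>i<K n. ennreal (norm (z n i)) * emeasure M (D n i))"
      using D(1) by (subst nn_integral_sum) (auto simp: nn_integral_cmult_indicator)
    also have "\<dots> = ennreal (\<Sum>i<K n. norm (z n i) * measure M (D n i))"
      by (subst sum_ennreal[symmetric]) (auto simp: ennreal_mult emeasure_eq_measure)
    also have "\<dots> \<le> ennreal V"
    proof (rule ennreal_leI)
      have "norm (z n i) * measure M (D n i) \<le> norm (F (D n i))" for i
        by (cases "measure M (D n i) = 0") (auto simp: z_def)
      then have "(\<Sum>i<K n. norm (z n i) * measure M (D n i)) \<le> (\<Sum>i<K n. norm (F (D n i)))"
        by (intro sum_mono)
      also have "\<dots> \<le> V" using D(1,2)[of n] by (intro V) (auto simp: disjoint_family_on_def)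
      finally show "(\<Sum>i<K n. norm (z n i) * measure M (D n i)) \<le> V" .
    qed
    finally show ?thesis .
  qed
  have g_int: "(\<integral>\<^sup>+x. norm (g x) \<partial>completion M) < \<infinity>"
  proof -
    have "(\<integral>\<^sup>+x. norm (g x) \<partial>completion M) = (\<integral>\<^sup>+x. liminf (\<lambda>n. ennreal (norm (s n x))) \<partial>completion M)"
    proof (rule nn_integral_cong_AE)
      show "AE x in completion M. ennreal (norm (g x)) = liminf (\<lambda>n. ennreal (norm (s n x)))"
        using AE_completion[OF lim]
      proof eventually_elim
        case (elim x)
        then have "(\<lambda>n. ennreal (norm (s n x))) \<longlonglongrightarrow> ennreal (norm (g x))"
          by (intro tendsto_ennrealI tendsto_norm) auto
        from lim_imp_Liminf[OF _ this] show ?case by simp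
      qed
    qed
    also have "\<dots> \<le> liminf (\<lambda>n. \<integral>\<^sup>+x. norm (s n x) \<partial>completion M)"
    proof (rule nn_integral_liminf)
      have "(\<lambda>x. norm (s n x)) \<in> borel_measurable M" for n
        by (intro borel_measurable_simple_function simple_function_compose1[OF s_simple])
      then show "(\<lambda>x. ennreal (norm (s n x))) \<in> borel_measurable (completion M)" for n
        by (intro measurable_compose[OF measurable_completion measurable_ennreal])
    qed
    also have "\<dots> \<le> limsup (\<lambda>n. \<integral>\<^sup>+x. norm (s n x) \<partial>completion M)"
      by (rule Liminf_le_Limsup) simp
    also have "\<dots> \<le> ennreal V" using s_int by (intro Limsup_bounded) auto
    finally show ?thesis by (auto simp: less_top[symmetric] top_unique)
  qed
  show ?thesis
  proof (intro exI[of _ g] ballI)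
    fix A assume A: "A \<in> sets M"
    define t where "t n x = indicat_real A x *\<^sub>R s n x" for n x
    have t_simple: "simple_function M (t n)" for n
      unfolding t_def[abs_def] using simple_function_indicator[OF A] s_simple
      by (rule simple_function_compose2)
    have t_lim: "AE x in M. (\<lambda>n. t n x) \<longlonglongrightarrow> indicat_real A x *\<^sub>R g x"
      using lim by eventually_elim (unfold t_def, intro tendsto_intros, blast)
    have sm: "strongly_measurable M (\<lambda>x. indicat_real A x *\<^sub>R g x)"
      unfolding strongly_measurable_def using t_simple t_lim by blast
    have "(\<lambda>n. \<integral>\<^sup>+x. norm (indicat_real A x *\<^sub>R g x - t n x) \<partial>completion M)
        \<longlonglongrightarrow> (\<integral>\<^sup>+x. 0 \<partial>completion M)"
    \<comment> \<open>On \<open>U n\<close> the distance of \<open>g\<close> and \<open>s n\<close> is at most \<open>\<epsilon> n \<le> 1\<close>; outside of \<open>U n\<close> the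
        function \<open>s n\<close> vanishes.\<close>
    proof (rule nn_integral_dominated_convergence[where w = "\<lambda>x. ennreal (1 + norm (g x))"])
      show "(\<lambda>x. ennreal (norm (indicat_real A x *\<^sub>R g x - t n x))) \<in> borel_measurable (completion M)" for n
        using strongly_measurable_norm_diff[OF sm strongly_measurable_simple[OF t_simple]] by measurable
      show "(\<lambda>x. ennreal (1 + norm (g x))) \<in> borel_measurable (completion M)" using g_meas by measurable
      show "AE x in completion M. ennreal (norm (indicat_real A x *\<^sub>R g x - t n x)) \<le> ennreal (1 + norm (g x))" for n
        using AE_completion[OF lim]
      proof eventually_elim
        case (elim x)
        have "norm (g x - s n x) \<le> 1 + norm (g x)"
        proof (cases "x \<in> U n")
          case True
          then have "norm (g x - s n x) \<le> 1" using elim \<epsilon>(2)[of n] by (meson order_trans)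
          then show ?thesis by (smt (verit) norm_ge_zero)
        qed (simp add: s_out)
        then show ?case by (intro ennreal_leI) (auto simp: t_def indicator_def)
      qed
      have "(\<integral>\<^sup>+x. ennreal (1 + norm (g x)) \<partial>completion M)
          = (\<integral>\<^sup>+x. 1 \<partial>completion M) + (\<integral>\<^sup>+x. ennreal (norm (g x)) \<partial>completion M)"
        using g_meas by (subst nn_integral_add[symmetric]) auto
      also have "\<dots> < \<infinity>" using g_int by (simp add: emeasure_eq_measure)
      finally show "(\<integral>\<^sup>+x. ennreal (1 + norm (g x)) \<partial>completion M) < \<infinity>" .
      show "AE x in completion M. (\<lambda>n. ennreal (norm (indicat_real A x *\<^sub>R g x - t n x))) \<longlonglongrightarrow> 0"
        using AE_completion[OF t_lim]
      proof eventually_elim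
        case (elim x)
        then have "(\<lambda>n. norm (indicat_real A x *\<^sub>R g x - t n x)) \<longlonglongrightarrow> norm (indicat_real A x *\<^sub>R g x - indicat_real A x *\<^sub>R g x)"
          by (intro tendsto_intros)
        then have "(\<lambda>n. ennreal (norm (indicat_real A x *\<^sub>R g x - t n x))) \<longlonglongrightarrow> ennreal 0"
          by (intro tendsto_ennrealI) simp
        then show ?case by simp
      qed
    qed auto
    then have conv: "(\<lambda>n. \<integral>\<^sup>+x. norm (indicat_real A x *\<^sub>R g x - t n x) \<partial>completion M) \<longlonglongrightarrow> 0" by simp
    have "(\<lambda>n. Bochner_Integration.simple_bochner_integral M (t n)) \<longlonglongrightarrow> F A"
    proof (rule Lim_null_comparison[THEN LIM_zero_cancel])
      have "norm (Bochner_Integration.simple_bochner_integral M (t n) - F A) \<le> \<epsilon> n * (measure M (space M) + 1)" for n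
      proof -
        have tn: "t n = (\<lambda>x. \<Sum>i<K n. indicator (A \<inter> D n i) x *\<^sub>R z n i)"
          by (intro ext) (simp only: t_def s_def scaleR_sum_right scaleR_scaleR indicator_inter_arith)
        have int: "Bochner_Integration.simple_bochner_integral M (t n) = (\<Sum>i<K n. measure M (A \<inter> D n i) *\<^sub>R z n i)"
          unfolding tn by (rule simple_bochner_integral_step) (use A D(1) in auto)
        have "disjoint_family_on (\<lambda>i. A \<inter> D n i) {..<K n}"
          using D(2)[of n] unfolding disjoint_family_on_def by blast
        then have "F (\<Union>i<K n. A \<inter> D n i) = (\<Sum>i<K n. F (A \<inter> D n i))"
          using A D(1) by (intro vector_measure_UN[OF F]) auto
        moreover have "(\<Union>i<K n. A \<inter> D n i) = A \<inter> U n" by (auto simp: U_def)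
        moreover have "F (A - A \<inter> U n) = F A - F (A \<inter> U n)"
          using A U by (intro vector_measure_Diff[OF F]) auto
        ultimately have FA: "F A = (\<Sum>i<K n. F (A \<inter> D n i)) + F (A - A \<inter> U n)" by simp
        have "measure M (A - A \<inter> U n) \<le> measure M (space M - U n)"
          using A U sets.sets_into_space[OF A] by (intro finite_measure_mono) auto
        also have "\<dots> < d n" using D(4)[of n] by (simp add: U_def)
        finally have small: "norm (F (A - A \<inter> U n)) \<le> \<epsilon> n"
          using A U by (intro less_imp_le d(2)) auto
        have "norm ((\<Sum>i<K n. measure M (A \<inter> D n i) *\<^sub>R z n i) - (\<Sum>i<K n. F (A \<inter> D n i)))
            \<le> (\<Sum>i<K n. \<epsilon> n * measure M (A \<inter> D n i))"
          unfolding sum_subtractf[symmetric]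
        proof (rule order_trans[OF norm_sum], rule sum_mono)
          show "norm (measure M (A \<inter> D n i) *\<^sub>R z n i - F (A \<inter> D n i)) \<le> \<epsilon> n * measure M (A \<inter> D n i)" for i
            using osc[of "A \<inter> D n i" n i] A D(1) by (auto simp: norm_minus_commute)
        qed
        also have "\<dots> = \<epsilon> n * measure M (\<Union>i<K n. A \<inter> D n i)"
          using \<open>disjoint_family_on (\<lambda>i. A \<inter> D n i) {..<K n}\<close> A D(1)
          by (subst finite_measure_finite_Union) (auto simp: sum_distrib_left)
        also have "\<dots> \<le> \<epsilon> n * measure M (space M)"
          using \<epsilon>(1)[of n] by (intro mult_left_mono bounded_measure) auto
        finally have *: "norm ((\<Sum>i<K n. measure M (A \<inter> D n i) *\<^sub>R z n i) - (\<Sum>i<K n. F (A \<inter> D n i)))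
          \<le> \<epsilon> n * measure M (space M)" .
        have "norm ((\<Sum>i<K n. measure M (A \<inter> D n i) *\<^sub>R z n i) - F A)
          \<le> norm ((\<Sum>i<K n. measure M (A \<inter> D n i) *\<^sub>R z n i) - (\<Sum>i<K n. F (A \<inter> D n i)))
            + norm (F (A - A \<inter> U n))"
          unfolding FA diff_diff_add[symmetric] by (rule norm_triangle_ineq4)
        with * small show ?thesis unfolding int by (simp add: algebra_simps)
      qed
      then show "\<forall>\<^sub>F n in sequentially. norm (Bochner_Integration.simple_bochner_integral M (t n) - F A)
          \<le> \<epsilon> n * (measure M (space M) + 1)" by simp
      show "(\<lambda>n. \<epsilon> n * (measure M (space M) + 1)) \<longlonglongrightarrow> 0"
        using tendsto_mult_right[OF \<epsilon>0, of "measure M (space M) + 1"] by simp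
    qed
    then show "has_strong_bochner_integral M (\<lambda>x. indicator A x *\<^sub>R g x) (F A)"
      unfolding has_strong_bochner_integral_def
      using sm conv t_simple by (intro conjI exI[of _ t]) (auto intro: simple_bochner_integrable)
  qed
qed

section \<open>Null sequences on a James boundary\<close>

lemma dual_unit_ballD:
  assumes "\<phi> \<in> dual_unit_ball V p"
  shows "f \<in> V \<Longrightarrow> g \<in> V \<Longrightarrow> \<phi> (\<lambda>x. f x + g x) = \<phi> f + \<phi> g"
    and "f \<in> V \<Longrightarrow> \<phi> (\<lambda>x. c *\<^sub>R f x) = c * \<phi> f"
    and "f \<in> V \<Longrightarrow> \<bar>\<phi> f\<bar> \<le> p f"
  using assms by (auto simp: dual_unit_ball_def)

text \<open>
  This is the heart of Simons' inequality. The vectors \<open>y\<^sub>k\<close> in \<open>C\<^sub>k\<close> are chosen one after the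
  other so that, with \<open>v\<^sub>k\<close> the sum of the \<open>2\<^sup>-\<^sup>i\<^sup>-\<^sup>1 y\<^sub>i\<close> for \<open>i < k\<close>, the norm of \<open>v\<^sub>k + 2\<^sup>-\<^sup>k
  y\<^sub>k\<close> is within \<open>\<epsilon>\<^sub>k\<close> of the infimum \<open>Q\<^sub>k\<close> of the norms of \<open>v\<^sub>k + 2\<^sup>-\<^sup>k y\<close> for \<open>y\<close> in \<open>C\<^sub>k\<close>.
  Convexity makes \<open>Q\<^sub>k\<close> increase with \<open>k\<close>, and \<open>\<delta> \<le> Q\<^sub>k \<le> p f\<close> for the full sum \<open>f\<close>. If \<open>\<phi>\<close>
  attains the norm of \<open>f\<close>, put \<open>d\<^sub>k = \<phi> f - \<phi> v\<^sub>k\<close>, so that \<open>d\<^sub>0 \<ge> \<delta>\<close>. The near minimality of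
  \<open>y\<^sub>k\<close> gives \<open>d\<^sub>k\<^sub>+\<^sub>1 \<ge> (d\<^sub>k - \<epsilon>\<^sub>k) / 2\<close>, hence \<open>2\<^sup>k d\<^sub>k \<ge> \<delta> / 2\<close> for all \<open>k\<close>. But \<open>2\<^sup>k d\<^sub>k\<close> is a
  weighted average of the values \<open>\<phi> y\<^sub>i\<close> with \<open>i \<ge> k\<close>, so these values cannot tend to 0.
\<close>

lemma boundary_nonattaining:
  fixes V :: "('a \<Rightarrow> 'x::real_normed_vector) set" and p :: "('a \<Rightarrow> 'x) \<Rightarrow> real"
  assumes add: "\<And>f g. f \<in> V \<Longrightarrow> g \<in> V \<Longrightarrow> (\<lambda>t. f t + g t) \<in> V"
    and scale: "\<And>f c. f \<in> V \<Longrightarrow> (\<lambda>t. c *\<^sub>R f t) \<in> V"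
    and p_add: "\<And>f g. f \<in> V \<Longrightarrow> g \<in> V \<Longrightarrow> p (\<lambda>t. f t + g t) \<le> p f + p g"
    and p_scale: "\<And>f c. f \<in> V \<Longrightarrow> p (\<lambda>t. c *\<^sub>R f t) = \<bar>c\<bar> * p f"
    and CV: "\<And>k. C k \<subseteq> V" and dec: "\<And>k. C (Suc k) \<subseteq> C k" and ne: "\<And>k. C k \<noteq> {}"
    and convex: "\<And>k y z. y \<in> C k \<Longrightarrow> z \<in> C k \<Longrightarrow> (\<lambda>t. (1/2) *\<^sub>R y t + (1/2) *\<^sub>R z t) \<in> C k"
    and \<delta>: "\<delta> > 0" "\<And>y. y \<in> C 0 \<Longrightarrow> \<delta> \<le> p y" and bound: "\<And>y. y \<in> C 0 \<Longrightarrow> p y \<le> L"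
    and complete: "\<And>y. (\<And>k. y k \<in> C k) \<Longrightarrow>
      \<exists>f\<in>V. (\<lambda>n. p (\<lambda>t. f t - (\<Sum>i<n. (1/2) ^ Suc i *\<^sub>R y i t))) \<longlonglongrightarrow> 0"
  shows "\<exists>f\<in>V. \<exists>y. (\<forall>k. y k \<in> C k) \<and>
    (\<forall>\<phi>\<in>dual_unit_ball V p. \<phi> f = p f \<longrightarrow> \<not> (\<lambda>k. \<phi> (y k)) \<longlonglongrightarrow> 0)"
proof -
  have zero: "(\<lambda>t. 0) \<in> V" using ne[of 0] CV[of 0] scale[of _ 0] by fastforce
  have p0: "p (\<lambda>t. 0) = 0" using p_scale[OF zero, of 0] by simp
  have p_nonneg: "p f \<ge> 0" if "f \<in> V" for f
    using p_add[OF that scale[OF that, of "-1"]] p_scale[OF that, of "-1"] p0 by simp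
  have diff: "(\<lambda>t. f t - g t) \<in> V" if "f \<in> V" "g \<in> V" for f g
    using add[OF that(1) scale[OF that(2), of "-1"]] by simp
  define w where "w v k y = (\<lambda>t. v t + (1/2) ^ k *\<^sub>R y t)" for v :: "'a \<Rightarrow> 'x" and k :: nat and y :: "'a \<Rightarrow> 'x"
  have wV: "w v k y \<in> V" if "v \<in> V" "y \<in> V" for v k y
    unfolding w_def using that by (intro add scale)
  define q where "q v k = Inf ((\<lambda>y. p (w v k y)) ` C k)" for v k
  \<comment> \<open>small enough for the sum of the \<open>2 ^ k * \<epsilon> k\<close> to be \<open>\<delta> / 2\<close>\<close>
  define \<epsilon> where "\<epsilon> k = \<delta> / 4 * (1/4) ^ k" for k :: nat
  have \<epsilon>: "\<epsilon> k > 0" for k using \<delta> by (simp add: \<epsilon>_def)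
  have bdd: "bdd_below ((\<lambda>y. p (w v k y)) ` C k)" if "v \<in> V" for v k
    using that wV p_nonneg CV by (intro bdd_belowI[of _ 0]) blast
  have q_le: "q v k \<le> p (w v k y)" if "v \<in> V" "y \<in> C k" for v k y
    unfolding q_def using that bdd by (intro cInf_lower) auto
  have "\<exists>y\<in>C k. v \<in> V \<longrightarrow> p (w v k y) \<le> q v k + \<epsilon> k" for v k
  proof (cases "v \<in> V")
    case True
    have "Inf ((\<lambda>y. p (w v k y)) ` C k) < q v k + \<epsilon> k" using \<epsilon>[of k] by (simp add: q_def)
    then obtain y where "y \<in> C k" "p (w v k y) < q v k + \<epsilon> k"
      using cInf_less_iff[OF _ bdd[OF True]] ne[of k] by auto
    then show ?thesis by (auto intro: less_imp_le)
  qed (use ne[of k] in blast)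
  note ex = this
  define pick where "pick v k = (SOME y. y \<in> C k \<and> (v \<in> V \<longrightarrow> p (w v k y) \<le> q v k + \<epsilon> k))" for v k
  have pick: "pick v k \<in> C k \<and> (v \<in> V \<longrightarrow> p (w v k (pick v k)) \<le> q v k + \<epsilon> k)" for v k
    using ex[of k v] unfolding pick_def Bex_def by (rule someI_ex)
  define v where "v = rec_nat (\<lambda>t. 0) (\<lambda>k u. w u (Suc k) (pick u k))"
  define y where "y k = pick (v k) k" for k
  have v0: "v 0 = (\<lambda>t. 0)" and vS: "v (Suc k) = w (v k) (Suc k) (y k)" for k
    by (simp_all add: v_def y_def)
  have yC: "y k \<in> C k" for k by (simp add: y_def pick)
  have yV: "y k \<in> V" for k using yC CV by blast
  have C0: "C k \<subseteq> C 0" for k by (rule lift_Suc_antimono_le[of C, OF dec]) simp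
  have vV: "v k \<in> V" for k by (induction k) (auto simp: v0 vS zero intro!: wV yV)
  have v_sum: "v n = (\<lambda>t. \<Sum>i<n. (1/2) ^ Suc i *\<^sub>R y i t)" for n
    by (induction n) (auto simp: v0 vS w_def)
  define Q where "Q k = q (v k) k" for k
  have Q_near: "p (w (v k) k (y k)) \<le> Q k + \<epsilon> k" for k
    unfolding Q_def y_def using pick vV by blast
  have "Q k \<le> Q (Suc k)" for k
    unfolding Q_def q_def[of "v (Suc k)"]
  proof (rule cInf_greatest)
    fix r assume "r \<in> (\<lambda>z. p (w (v (Suc k)) (Suc k) z)) ` C (Suc k)"
    then obtain z where z: "z \<in> C (Suc k)" "r = p (w (v (Suc k)) (Suc k) z)" by auto
    have "w (v (Suc k)) (Suc k) z = w (v k) k (\<lambda>t. (1/2) *\<^sub>R y k t + (1/2) *\<^sub>R z t)"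
      unfolding vS w_def by (auto simp: algebra_simps)
    then have "r = p (w (v k) k (\<lambda>t. (1/2) *\<^sub>R y k t + (1/2) *\<^sub>R z t))" by (simp add: z(2))
    also have "\<dots> \<ge> q (v k) k" using z(1) dec yC by (intro q_le vV convex) auto
    finally show "q (v k) k \<le> r" by simp
  qed (use ne in auto)
  then have Q_mono: "Q k \<le> Q m" if "k \<le> m" for k m by (rule lift_Suc_mono_le[OF _ that])
  have "\<delta> \<le> Q 0"
    unfolding Q_def q_def by (rule cInf_greatest) (use ne \<delta>(2) in \<open>auto simp: w_def v0\<close>)
  then have Q_\<delta>: "\<delta> \<le> Q k" for k using Q_mono[of 0 k] by simp
  from complete[OF yC] obtain f where f: "f \<in> V"
    "(\<lambda>n. p (\<lambda>t. f t - (\<Sum>i<n. (1/2) ^ Suc i *\<^sub>R y i t))) \<longlonglongrightarrow> 0" by blast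
  then have lim: "(\<lambda>n. p (\<lambda>t. f t - v n t)) \<longlonglongrightarrow> 0" by (simp add: v_sum)
  have Q_f: "Q k \<le> p f" for k
  proof (rule LIMSEQ_le_const)
    show "(\<lambda>m. p f + p (\<lambda>t. f t - v m t) + (1/2) ^ m * L) \<longlonglongrightarrow> p f"
      using tendsto_add[OF tendsto_add[OF tendsto_const[of "p f"] lim]
        tendsto_mult_left_zero[OF LIMSEQ_power_zero[of "1/2::real"], of L]] by simp
    have "Q k \<le> p f + p (\<lambda>t. f t - v m t) + (1/2) ^ m * L" if "k \<le> m" for m
    proof -
      have "Q k \<le> p (w (v m) m (y m))"
        using Q_mono[OF that] q_le[OF vV[of m] yC[of m]] by (simp add: Q_def)
      also have "w (v m) m (y m) = (\<lambda>t. (f t + (-1) *\<^sub>R (f t - v m t)) + (1/2) ^ m *\<^sub>R y m t)"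
        by (simp add: w_def)
      also have "p \<dots> \<le> p (\<lambda>t. f t + (-1) *\<^sub>R (f t - v m t)) + p (\<lambda>t. (1/2) ^ m *\<^sub>R y m t)"
        by (intro p_add add scale diff f vV yV)
      also have "p (\<lambda>t. f t + (-1) *\<^sub>R (f t - v m t)) \<le> p f + p (\<lambda>t. (-1) *\<^sub>R (f t - v m t))"
        by (intro p_add scale diff f vV)
      also have "p (\<lambda>t. (-1) *\<^sub>R (f t - v m t)) = p (\<lambda>t. f t - v m t)"
        by (subst p_scale) (auto intro: diff f vV)
      also have "p (\<lambda>t. (1/2) ^ m *\<^sub>R y m t) = (1/2) ^ m * p (y m)"
        by (subst p_scale) (auto intro: yV)
      also have "\<dots> \<le> (1/2) ^ m * L" using yC C0 by (intro mult_left_mono bound) auto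
      finally show ?thesis by simp
    qed
    then show "\<exists>N. \<forall>m\<ge>N. Q k \<le> p f + p (\<lambda>t. f t - v m t) + (1/2) ^ m * L" by blast
  qed
  show ?thesis
  proof (intro bexI[OF _ f(1)] exI[of _ y] conjI allI ballI impI notI)
    fix \<phi> assume \<phi>: "\<phi> \<in> dual_unit_ball V p" and att: "\<phi> f = p f" and null: "(\<lambda>k. \<phi> (y k)) \<longlonglongrightarrow> 0"
    note \<phi>_add = dual_unit_ballD(1)[OF \<phi>] and \<phi>_scale = dual_unit_ballD(2)[OF \<phi>]
      and \<phi>_le = dual_unit_ballD(3)[OF \<phi>]
    have \<phi>_w: "\<phi> (w u k z) = \<phi> u + (1/2) ^ k * \<phi> z" if "u \<in> V" "z \<in> V" for u k z
      unfolding w_def using that by (subst \<phi>_add) (auto intro: scale simp: \<phi>_scale)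
    have \<phi>_v: "\<phi> (v (Suc k)) = \<phi> (v k) + (1/2) ^ Suc k * \<phi> (y k)" for k
      unfolding vS by (rule \<phi>_w[OF vV yV])
    have lower: "2 ^ k * (p f - \<phi> (v k)) \<ge> \<delta> / 2 + \<delta> / 2 * (1/2) ^ k" for k
    proof (induction k)
      case 0
      have "\<phi> (v 0) = 0" using \<phi>_scale[OF zero, of 0] by (simp add: v0)
      then show ?case using Q_\<delta>[of 0] Q_f[of 0] by simp
    next
      case (Suc k)
      have "\<phi> (v k) + (1/2) ^ k * \<phi> (y k) \<le> p f + \<epsilon> k"
        using \<phi>_le[OF wV[OF vV yV], of k k k] \<phi>_w[OF vV yV, of k k k] Q_near[of k] Q_f[of k] by linarith
      then have "2 ^ k * (\<phi> (v k) + (1/2) ^ k * \<phi> (y k)) \<le> 2 ^ k * (p f + \<epsilon> k)"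
        by (intro mult_left_mono) auto
      moreover have half: "(2::real) ^ k * (1/2) ^ k = 1" by (simp add: power_mult_distrib[symmetric])
      moreover have "2 ^ k * \<epsilon> k = \<delta> / 4 * (1/2) ^ k"
        unfolding \<epsilon>_def by (simp add: power_mult_distrib[symmetric])
      ultimately have "2 ^ k * \<phi> (v k) + \<phi> (y k) \<le> 2 ^ k * p f + \<delta> / 4 * (1/2) ^ k"
        by (simp add: distrib_left mult.assoc[symmetric])
      moreover have "2 ^ Suc k * (p f - \<phi> (v (Suc k))) = 2 * (2 ^ k * p f) - 2 * (2 ^ k * \<phi> (v k)) - \<phi> (y k)"
        using half unfolding \<phi>_v by (simp add: right_diff_distrib distrib_left mult.assoc[symmetric])
      moreover have "2 ^ k * p f - 2 ^ k * \<phi> (v k) \<ge> \<delta> / 2 + \<delta> / 2 * (1/2) ^ k"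
        using Suc by (simp add: right_diff_distrib)
      ultimately show ?case by simp
    qed
    have "\<forall>\<^sub>F k in sequentially. \<phi> (y k) < \<delta> / 4" using null \<delta>(1) by (intro order_tendstoD) auto
    then obtain k where k: "\<And>m. m \<ge> k \<Longrightarrow> \<phi> (y m) < \<delta> / 4" by (auto simp: eventually_sequentially)
    have upper: "\<phi> (v m) \<le> \<phi> (v k) + \<delta> / 4 * ((1/2) ^ k - (1/2) ^ m)" if "m \<ge> k" for m
      using that
    proof (induction m rule: dec_induct)
      case (step m)
      have "(1/2) ^ Suc m * \<phi> (y m) \<le> (1/2) ^ Suc m * (\<delta> / 4)"
        using k[OF step(1)] by (intro mult_left_mono) auto
      moreover have "\<delta> / 4 * ((1/2) ^ k - (1/2) ^ Suc m)
          = \<delta> / 4 * ((1/2) ^ k - (1/2) ^ m) + (1/2) ^ Suc m * (\<delta> / 4)" by (simp add: algebra_simps)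
      ultimately show ?case using step.IH unfolding \<phi>_v by linarith
    qed simp
    have "\<phi> f \<le> \<phi> (v k) + \<delta> / 4 * (1/2) ^ k"
    proof (rule LIMSEQ_le_const[OF _ exI])
      show "(\<lambda>m. \<phi> (v k) + \<delta> / 4 * (1/2) ^ k + p (\<lambda>t. f t - v m t)) \<longlonglongrightarrow> \<phi> (v k) + \<delta> / 4 * (1/2) ^ k"
        using tendsto_add[OF tendsto_const lim] by simp
      show "\<forall>m\<ge>k. \<phi> f \<le> \<phi> (v k) + \<delta> / 4 * (1/2) ^ k + p (\<lambda>t. f t - v m t)"
      proof (intro allI impI)
        fix m assume m: "m \<ge> k"
        have "\<phi> (\<lambda>t. v m t + (f t - v m t)) = \<phi> (v m) + \<phi> (\<lambda>t. f t - v m t)"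
          by (intro \<phi>_add vV diff f)
        then have "\<phi> f = \<phi> (v m) + \<phi> (\<lambda>t. f t - v m t)" by simp
        moreover have "\<bar>\<phi> (\<lambda>t. f t - v m t)\<bar> \<le> p (\<lambda>t. f t - v m t)" by (intro \<phi>_le diff f vV)
        moreover have "\<delta> / 4 * ((1/2) ^ k - (1/2) ^ m) \<le> \<delta> / 4 * (1/2) ^ k"
          using \<delta> by (intro mult_left_mono) auto
        ultimately show "\<phi> f \<le> \<phi> (v k) + \<delta> / 4 * (1/2) ^ k + p (\<lambda>t. f t - v m t)"
          using upper[OF m] by linarith
      qed
    qed
    then have "2 ^ k * (p f - \<phi> (v k)) \<le> 2 ^ k * (\<delta> / 4 * (1/2) ^ k)"
      using att by (intro mult_left_mono) auto
    also have "\<dots> = \<delta> / 4" by (simp add: power_mult_distrib[symmetric])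
    finally have "2 ^ k * (p f - \<phi> (v k)) \<le> \<delta> / 4" .
    moreover have "\<delta> / 2 * (1/2) ^ k \<ge> 0" using \<delta> by simp
    ultimately show False using lower[of k] \<delta>(1) by linarith
  qed (rule yC)
qed

text \<open>
  Dyadic convex combinations of the \<open>f n\<close> with \<open>n \<ge> k\<close>. Closure under midpoints is all the
  convexity that \<open>boundary_nonattaining\<close> needs, and it makes rule induction immediate.
\<close>

inductive_set tail_hull :: "(nat \<Rightarrow> 'a \<Rightarrow> 'x::real_vector) \<Rightarrow> nat \<Rightarrow> ('a \<Rightarrow> 'x) set"
  for f :: "nat \<Rightarrow> 'a \<Rightarrow> 'x" and k :: nat where
  generator: "k \<le> n \<Longrightarrow> f n \<in> tail_hull f k"
| midpoint: "y \<in> tail_hull f k \<Longrightarrow> z \<in> tail_hull f k \<Longrightarrow>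
    (\<lambda>t. (1/2) *\<^sub>R y t + (1/2) *\<^sub>R z t) \<in> tail_hull f k"

lemma tail_hull_mono:
  assumes "y \<in> tail_hull f m" "k \<le> m"
  shows "y \<in> tail_hull f k"
  using assms by induction (auto intro: tail_hull.intros)

lemma tail_hull_subset:
  assumes "\<And>f g. f \<in> V \<Longrightarrow> g \<in> V \<Longrightarrow> (\<lambda>t. f t + g t) \<in> V"
    and "\<And>f c. f \<in> V \<Longrightarrow> (\<lambda>t. c *\<^sub>R f t) \<in> V" and "\<And>n. f n \<in> V"
  shows "tail_hull f k \<subseteq> V"
proof
  fix y assume "y \<in> tail_hull f k"
  then show "y \<in> V" by induction (use assms in blast)+
qed

lemma tail_hull_null_sequence:
  assumes \<phi>: "\<phi> \<in> dual_unit_ball V p"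
    and scale: "\<And>f c. f \<in> V \<Longrightarrow> (\<lambda>t. c *\<^sub>R f t) \<in> V"
    and V: "\<And>k. tail_hull f k \<subseteq> V" and null: "(\<lambda>n. \<phi> (f n)) \<longlonglongrightarrow> 0" and y: "\<And>k. y k \<in> tail_hull f k"
  shows "(\<lambda>k. \<phi> (y k)) \<longlonglongrightarrow> 0"
proof (rule LIMSEQ_I)
  fix e :: real assume "e > 0"
  then obtain n0 where n0: "\<And>n. n \<ge> n0 \<Longrightarrow> \<bar>\<phi> (f n)\<bar> < e"
    using LIMSEQ_D[OF null] by (metis diff_zero real_norm_def)
  have "\<bar>\<phi> z\<bar> < e" if "z \<in> tail_hull f n0" for z
    using that
  proof induction
    case (midpoint z z')
    then have "z \<in> V" "z' \<in> V" using V by auto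
    then have "\<phi> (\<lambda>t. (1/2) *\<^sub>R z t + (1/2) *\<^sub>R z' t) = (1/2) * \<phi> z + (1/2) * \<phi> z'"
      using dual_unit_ballD(1,2)[OF \<phi>] scale by simp
    then show ?case using midpoint by (simp add: abs_if split: if_splits)
  qed (rule n0)
  then show "\<exists>no. \<forall>n\<ge>no. norm (\<phi> (y n) - 0) < e"
    using tail_hull_mono[OF y] by auto
qed

text \<open>
  If all elements of \<open>tail_hull f 0\<close> had norm at least \<open>\<delta>\<close>, then \<open>boundary_nonattaining\<close>, applied
  to the hulls of the tails of \<open>f\<close>, would produce \<open>g\<close> and \<open>y\<close> such that the boundary functional
  attaining the norm of \<open>g\<close> does not tend to 0 along \<open>y\<close>. It does, since \<open>y k\<close> belongs to the hull
  of the \<open>k\<close>-th tail.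
\<close>

lemma james_boundary_null_sequence:
  fixes V :: "('a \<Rightarrow> 'x::real_normed_vector) set" and p :: "('a \<Rightarrow> 'x) \<Rightarrow> real"
  assumes add: "\<And>f g. f \<in> V \<Longrightarrow> g \<in> V \<Longrightarrow> (\<lambda>t. f t + g t) \<in> V"
    and scale: "\<And>f c. f \<in> V \<Longrightarrow> (\<lambda>t. c *\<^sub>R f t) \<in> V"
    and p_add: "\<And>f g. f \<in> V \<Longrightarrow> g \<in> V \<Longrightarrow> p (\<lambda>t. f t + g t) \<le> p f + p g"
    and p_scale: "\<And>f c. f \<in> V \<Longrightarrow> p (\<lambda>t. c *\<^sub>R f t) = \<bar>c\<bar> * p f"
    and H: "james_boundary V p H"
    and f: "\<And>n. f n \<in> V" and bound: "\<And>y. y \<in> tail_hull f 0 \<Longrightarrow> p y \<le> L"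
    and complete: "\<And>y. (\<And>k. y k \<in> tail_hull f k) \<Longrightarrow>
      \<exists>g\<in>V. (\<lambda>n. p (\<lambda>t. g t - (\<Sum>i<n. (1/2) ^ Suc i *\<^sub>R y i t))) \<longlonglongrightarrow> 0"
    and null: "\<And>\<phi>. \<phi> \<in> H \<Longrightarrow> (\<lambda>n. \<phi> (f n)) \<longlonglongrightarrow> 0" and \<delta>: "\<delta> > 0"
  shows "\<exists>y\<in>tail_hull f 0. p y < \<delta>"
proof (rule ccontr)
  assume "\<not> ?thesis"
  then have low: "\<delta> \<le> p y" if "y \<in> tail_hull f 0" for y using that by force
  have sub: "tail_hull f k \<subseteq> V" for k by (rule tail_hull_subset[OF add scale f])
  have "\<exists>g\<in>V. \<exists>y. (\<forall>k. y k \<in> tail_hull f k) \<and>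
    (\<forall>\<phi>\<in>dual_unit_ball V p. \<phi> g = p g \<longrightarrow> \<not> (\<lambda>k. \<phi> (y k)) \<longlonglongrightarrow> 0)"
  proof (rule boundary_nonattaining[where \<delta> = \<delta> and L = L])
    show "tail_hull f (Suc k) \<subseteq> tail_hull f k" for k by (auto intro: tail_hull_mono)
    show "tail_hull f k \<noteq> {}" for k using tail_hull.generator[of k k f] by blast
  qed (use add scale p_add p_scale sub \<delta> low bound complete in \<open>auto intro: tail_hull.midpoint\<close>)
  then obtain g y where g: "g \<in> V" and y: "\<And>k. y k \<in> tail_hull f k"
    and no: "\<And>\<phi>. \<phi> \<in> dual_unit_ball V p \<Longrightarrow> \<phi> g = p g \<Longrightarrow> \<not> (\<lambda>k. \<phi> (y k)) \<longlonglongrightarrow> 0" by metis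
  from H g obtain \<phi> where \<phi>: "\<phi> \<in> H" "\<phi> \<in> dual_unit_ball V p" "p g = \<phi> g"
    unfolding james_boundary_def by blast
  from no[OF \<phi>(2) \<phi>(3)[symmetric]] tail_hull_null_sequence[OF \<phi>(2) scale sub null[OF \<phi>(1)] y]
  show False by blast
qed

section \<open>Weakly null sequences of functions\<close>

text \<open>
  Bessel's inequality: with \<open>K\<close> bounding the squares of the \<open>L\<^sub>2\<close>-norms of the \<open>u\<^sub>n\<close> and \<open>a\<^sub>n\<close> the
  integral of \<open>g u\<^sub>n\<close>, subtracting \<open>(a\<^sub>n / K) u\<^sub>n\<close> from \<open>g\<close> for one \<open>n\<close> after the other lowers the
  square of the \<open>L\<^sub>2\<close>-norm by at least \<open>a\<^sub>n\<^sup>2 / K\<close> each time, so the \<open>a\<^sub>n\<^sup>2\<close> are summable.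
\<close>

lemma (in finite_measure) orthogonal_sequence_null:
  fixes u :: "nat \<Rightarrow> 'a \<Rightarrow> real"
  assumes u: "\<And>n. u n \<in> borel_measurable M" "\<And>n x. \<bar>u n x\<bar> \<le> C"
    and orth: "\<And>m n. m < n \<Longrightarrow> (LINT x|M. u m x * u n x) = 0"
    and g: "g \<in> borel_measurable M" "\<And>x. \<bar>g x\<bar> \<le> 1"
  shows "(\<lambda>n. LINT x|M. g x * u n x) \<longlonglongrightarrow> 0"
proof -
  have C: "C \<ge> 0" using u(2)[of 0 undefined] by linarith
  \<comment> \<open>the summand 1 only keeps \<open>K\<close> positive\<close>
  define K where "K = C\<^sup>2 * measure M (space M) + 1"
  have K: "K > 0" unfolding K_def by (intro add_nonneg_pos mult_nonneg_nonneg) auto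
  define a where "a n = (LINT x|M. g x * u n x)" for n
  define S where "S n x = (\<Sum>k<n. a k / K * u k x)" for n x
  define B where "B n = (\<Sum>k<n. \<bar>a k / K\<bar> * C)" for n
  have S: "S n \<in> borel_measurable M" "\<bar>S n x\<bar> \<le> B n" for n x
  proof -
    show "S n \<in> borel_measurable M" unfolding S_def[abs_def] using u(1) by measurable
    have "\<bar>S n x\<bar> \<le> (\<Sum>k<n. \<bar>a k / K * u k x\<bar>)" unfolding S_def by (rule sum_abs)
    also have "\<dots> \<le> B n" unfolding B_def abs_mult by (intro sum_mono mult_left_mono u(2)) auto
    finally show "\<bar>S n x\<bar> \<le> B n" .
  qed
  have int: "integrable M (\<lambda>x. f x * h x)"
    if "f \<in> borel_measurable M" "\<And>x. \<bar>f x\<bar> \<le> b" "h \<in> borel_measurable M" "\<And>x. \<bar>h x\<bar> \<le> c" for f h :: "'a \<Rightarrow> real" and b c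
  proof (rule integrable_const_bound[of _ "b * c"])
    have "\<bar>f x * h x\<bar> \<le> b * c" for x
      unfolding abs_mult using that(2,4) abs_ge_zero order_trans by (intro mult_mono) blast+
    then show "AE x in M. norm (f x * h x) \<le> b * c" by simp
  qed (use that in measurable)
  note [simp] = int[OF u(1) u(2) u(1) u(2)] int[OF g u(1) u(2)] int[OF S u(1) u(2)] int[OF g g]
    int[OF S S] int[OF g S] int[OF u(1) u(2) S]
  have Su: "(LINT x|M. S n x * u n x) = 0" for n
  proof -
    have "(LINT x|M. S n x * u n x) = (LINT x|M. (\<Sum>k<n. a k / K * (u k x * u n x)))"
      unfolding S_def by (intro Bochner_Integration.integral_cong) (auto simp: sum_distrib_right mult.assoc)
    also have "\<dots> = (\<Sum>k<n. (LINT x|M. a k / K * (u k x * u n x)))"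
      by (intro Bochner_Integration.integral_sum) auto
    also have "\<dots> = 0" using orth by (intro sum.neutral) auto
    finally show ?thesis .
  qed
  have uu: "(LINT x|M. u n x * u n x) \<le> K" for n
  proof -
    have "u n x * u n x \<le> C\<^sup>2" for x
      using u(2)[of n x] C by (simp add: power2_eq_square[symmetric] abs_le_square_iff[symmetric])
    then have "(LINT x|M. u n x * u n x) \<le> (LINT x|M. C\<^sup>2)"
      by (intro integral_mono) auto
    then show ?thesis by (simp add: K_def mult.commute)
  qed
  define R where "R n = (LINT x|M. (g x - S n x)\<^sup>2)" for n
  have R_Suc: "R (Suc n) \<le> R n - (a n)\<^sup>2 / K" for n
  proof -
    have "R (Suc n) = (LINT x|M. (g x - S n x)\<^sup>2 - 2 * (a n / K) * (g x * u n x - S n x * u n x)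
        + (a n / K)\<^sup>2 * (u n x * u n x))"
      unfolding R_def S_def by (intro Bochner_Integration.integral_cong) (auto simp: power2_eq_square algebra_simps)
    also have "\<dots> = R n - 2 * (a n / K) * (a n - 0) + (a n / K)\<^sup>2 * (LINT x|M. u n x * u n x)"
    proof -
      have "integrable M (\<lambda>x. (g x - S n x)\<^sup>2)"
        unfolding power2_diff by (simp add: power2_eq_square mult.assoc)
      then show ?thesis
        by (simp add: R_def a_def Su)
    qed
    also have "\<dots> \<le> R n - 2 * (a n / K) * (a n - 0) + (a n / K)\<^sup>2 * K"
      using uu by (intro add_left_mono mult_left_mono) auto
    also have "\<dots> = R n - (a n)\<^sup>2 / K" using K by (simp add: field_simps power2_eq_square)
    finally show ?thesis .
  qed
  have "R n \<le> R 0 - (\<Sum>k<n. (a k)\<^sup>2) / K" for n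
  proof (induction n)
    case (Suc n)
    then show ?case using R_Suc[of n] by (simp add: add_divide_distrib)
  qed simp
  moreover have "R n \<ge> 0" for n unfolding R_def by simp
  ultimately have "(\<Sum>k<n. (a k)\<^sup>2) / K \<le> R 0" for n by (smt (verit))
  then have "(\<Sum>k<n. (a k)\<^sup>2) \<le> R 0 * K" for n using K by (simp add: field_simps)
  then have "summable (\<lambda>k. (a k)\<^sup>2)" by (intro summableI_nonneg_bounded) auto
  then have "(\<lambda>k. (a k)\<^sup>2) \<longlonglongrightarrow> 0" by (rule summable_LIMSEQ_zero)
  then have "(\<lambda>k. sqrt ((a k)\<^sup>2)) \<longlonglongrightarrow> sqrt 0" by (rule tendsto_real_sqrt)
  then show ?thesis unfolding a_def by (simp add: tendsto_rabs_zero_iff)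
qed

text \<open>
  For simple functions \<open>g\<close> the claim follows from the hypothesis by linearity, and since the
  functions \<open>f\<^sub>n\<close> are uniformly bounded it passes to limits in mean. Cutting the approximating
  simple functions off where they exceed \<open>2 * norm g\<close> gives domination, at the price that they are
  measurable for the completion only.
\<close>

lemma (in finite_measure) weakly_null_functions:
  fixes f :: "nat \<Rightarrow> 'a \<Rightarrow> 'x::real_normed_vector" and g :: "'a \<Rightarrow> 'x \<Rightarrow>\<^sub>L real"
  assumes f: "\<And>n. simple_function M (f n)" "\<And>n t. norm (f n t) \<le> 1"
    and null: "\<And>(z :: 'x \<Rightarrow>\<^sub>L real) B. B \<in> sets (completion M) \<Longrightarrow>
      (\<lambda>n. LINT t|completion M. indicator B t * blinfun_apply z (f n t)) \<longlonglongrightarrow> 0"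
    and g: "strongly_measurable M g" "integrable (completion M) (\<lambda>t. norm (g t))"
  shows "(\<lambda>n. LINT t|completion M. blinfun_apply (g t) (f n t)) \<longlonglongrightarrow> 0"
proof -
  let ?M = "completion M"
  have fin: "finite_measure ?M" by (rule finite_measureI) (simp add: emeasure_eq_measure)
  obtain s where s: "\<And>n. simple_function M (s n)" "AE t in M. (\<lambda>n. s n t) \<longlonglongrightarrow> g t"
    using g(1) unfolding strongly_measurable_def by blast
  have norm_g: "(\<lambda>t. norm (g t)) \<in> borel_measurable ?M" using g(1) by (rule strongly_measurable_norm)
  define r where "r m t = (if norm (s m t) \<le> 2 * norm (g t) then s m t else 0)" for m t
  have r_simple: "simple_function ?M (r m)" for m
    unfolding r_def[abs_def]
  proof (rule simple_function_If)
    have "(\<lambda>t. norm (s m t)) \<in> borel_measurable ?M"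
      by (intro strongly_measurable_norm strongly_measurable_simple s)
    then show "{t \<in> space ?M. norm (s m t) \<le> 2 * norm (g t)} \<in> sets ?M"
      using norm_g by measurable
  qed (auto intro: simple_function_completion s)
  have r_le: "norm (r m t) \<le> 2 * norm (g t)" for m t by (simp add: r_def)
  have r_lim: "AE t in ?M. (\<lambda>m. r m t) \<longlonglongrightarrow> g t"
    using AE_completion[OF s(2)]
  proof eventually_elim
    case (elim t)
    show ?case
    proof (cases "g t = 0")
      case True
      then have "r m t = 0" for m by (simp add: r_def)
      with True show ?thesis by simp
    next
      case False
      have "(\<lambda>n. norm (s n t)) \<longlonglongrightarrow> norm (g t)" using elim by (rule tendsto_norm)
      then have "\<forall>\<^sub>F n in sequentially. norm (s n t) < 2 * norm (g t)"
        using False by (intro order_tendstoD) auto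
      then have "\<forall>\<^sub>F n in sequentially. s n t = r n t" by eventually_elim (simp add: r_def)
      with elim show ?thesis by (rule Lim_transform_eventually)
    qed
  qed
  have f_sm: "strongly_measurable M (f n)" for n using f(1) by (rule strongly_measurable_simple)
  have fc: "simple_function ?M (f n)" for n using f(1) by (rule simple_function_completion)
  have diff_meas: "(\<lambda>t. norm (g t - r m t)) \<in> borel_measurable ?M" for m
  proof (rule borel_measurable_completion_AE_limit)
    show "AE t in M. (\<lambda>n. norm (s n t - r m t)) \<longlonglongrightarrow> norm (g t - r m t)"
      using s(2) by eventually_elim (intro tendsto_intros)
    show "(\<lambda>t. norm (s n t - r m t)) \<in> borel_measurable ?M" for n
      by (intro borel_measurable_simple_function simple_function_compose2[where h = "\<lambda>y z. norm (y - z)"]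
        simple_function_completion s r_simple)
  qed
  have rf_simple: "simple_function ?M (\<lambda>t. blinfun_apply (r m t) (f n t))" for m n
    by (intro simple_function_compose2[where h = blinfun_apply] r_simple fc)
  have le: "\<bar>blinfun_apply z (f n t)\<bar> \<le> norm z" for z n t
    using norm_blinfun[of z "f n t"] mult_left_mono[OF f(2)[of n t], of "norm z"] by simp
  have gf: "integrable ?M (\<lambda>t. blinfun_apply (g t) (f n t))" for n
    using le by (intro Bochner_Integration.integrable_bound[OF g(2)] strongly_measurable_blinfun_apply g f_sm) auto
  have rf: "integrable ?M (\<lambda>t. blinfun_apply (r m t) (f n t))" for m n
  proof (rule Bochner_Integration.integrable_bound)
    show "integrable ?M (\<lambda>t. 2 * norm (g t))" using g(2) by simp
    show "AE t in ?M. norm (blinfun_apply (r m t) (f n t)) \<le> norm (2 * norm (g t))"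
      using order_trans[OF le r_le] by simp
  qed (intro borel_measurable_simple_function rf_simple)
  have diff_int: "integrable ?M (\<lambda>t. norm (g t - r m t))" for m
  proof (rule Bochner_Integration.integrable_bound)
    show "integrable ?M (\<lambda>t. 3 * norm (g t))" using g(2) by simp
    have "norm (g t - r m t) \<le> 3 * norm (g t)" for t
      using norm_triangle_ineq4[of "g t" "r m t"] r_le[of m t] by linarith
    then show "AE t in ?M. norm (norm (g t - r m t)) \<le> norm (3 * norm (g t))" by simp
  qed (rule diff_meas)
  have approx: "(\<lambda>m. LINT t|?M. norm (g t - r m t)) \<longlonglongrightarrow> (LINT t|?M. 0)"
  proof (rule integral_dominated_convergence)
    show "integrable ?M (\<lambda>t. 3 * norm (g t))" using g(2) by simp
    have "norm (g t - r m t) \<le> 3 * norm (g t)" for m t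
      using norm_triangle_ineq4[of "g t" "r m t"] r_le[of m t] by linarith
    then show "AE t in ?M. norm (norm (g t - r m t)) \<le> 3 * norm (g t)" for m by simp
    show "AE t in ?M. (\<lambda>m. norm (g t - r m t)) \<longlonglongrightarrow> 0"
      using r_lim
    proof eventually_elim
      case (elim t)
      have "(\<lambda>m. norm (g t - r m t)) \<longlonglongrightarrow> norm (g t - g t)" by (intro tendsto_intros elim)
      then show ?case by simp
    qed
  qed (auto intro: diff_meas)
  have simple_null: "(\<lambda>n. LINT t|?M. blinfun_apply (r m t) (f n t)) \<longlonglongrightarrow> 0" for m
  proof -
    let ?B = "\<lambda>z. r m -` {z} \<inter> space ?M"
    have B: "?B z \<in> sets ?M" for z using r_simple[of m] by (rule simple_functionD)
    have fin_r: "finite (r m ` space ?M)" using r_simple[of m] by (rule simple_functionD)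
    have "(LINT t|?M. blinfun_apply (r m t) (f n t))
        = (\<Sum>z\<in>r m ` space ?M. LINT t|?M. indicator (?B z) t * blinfun_apply z (f n t))" for n
    proof -
      have "(LINT t|?M. blinfun_apply (r m t) (f n t))
          = (LINT t|?M. (\<Sum>z\<in>r m ` space ?M. indicator (?B z) t * blinfun_apply z (f n t)))"
      proof (rule Bochner_Integration.integral_cong[OF refl])
        fix t assume t: "t \<in> space ?M"
        have "(\<Sum>z\<in>r m ` space ?M. indicator (?B z) t * blinfun_apply z (f n t))
            = (\<Sum>z\<in>r m ` space ?M. if z = r m t then blinfun_apply (r m t) (f n t) else 0)"
          using t by (intro sum.cong) auto
        also have "\<dots> = blinfun_apply (r m t) (f n t)" using t fin_r by (simp add: sum.delta)
        finally show "blinfun_apply (r m t) (f n t)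
            = (\<Sum>z\<in>r m ` space ?M. indicator (?B z) t * blinfun_apply z (f n t))" by simp
      qed
      also have "\<dots> = (\<Sum>z\<in>r m ` space ?M. LINT t|?M. indicator (?B z) t * blinfun_apply z (f n t))"
      proof (rule Bochner_Integration.integral_sum)
        fix z
        show "integrable ?M (\<lambda>t. indicator (?B z) t * blinfun_apply z (f n t))"
        proof (rule finite_measure.integrable_const_bound[OF fin, of _ "norm z"])
          show "AE t in ?M. norm (indicator (?B z) t * blinfun_apply z (f n t)) \<le> norm z"
            using le[of z n] by (auto simp: indicator_def)
          have "(\<lambda>t. blinfun_apply z (f n t)) \<in> borel_measurable ?M"
            by (intro borel_measurable_simple_function simple_function_compose1[OF fc])
          then show "(\<lambda>t. indicator (?B z) t * blinfun_apply z (f n t)) \<in> borel_measurable ?M"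
            using B[of z] by (intro borel_measurable_times borel_measurable_indicator)
        qed
      qed
      finally show ?thesis .
    qed
    moreover have "(\<lambda>n. \<Sum>z\<in>r m ` space ?M. LINT t|?M. indicator (?B z) t * blinfun_apply z (f n t))
        \<longlonglongrightarrow> (\<Sum>z\<in>r m ` space ?M. 0)"
      by (intro tendsto_sum) (rule null[OF B])
    ultimately show ?thesis by simp
  qed
  show ?thesis
  proof (rule LIMSEQ_I)
    fix e :: real assume "e > 0"
    then have "\<forall>\<^sub>F m in sequentially. (LINT t|?M. norm (g t - r m t)) < e / 2"
      using approx by (intro order_tendstoD) auto
    then obtain m where m: "(LINT t|?M. norm (g t - r m t)) < e / 2"
      by (auto simp: eventually_sequentially)
    obtain n0 where n0: "\<And>n. n \<ge> n0 \<Longrightarrow> \<bar>LINT t|?M. blinfun_apply (r m t) (f n t)\<bar> < e / 2"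
      using LIMSEQ_D[OF simple_null[of m], of "e / 2"] \<open>e > 0\<close> by auto
    have "\<bar>LINT t|?M. blinfun_apply (g t) (f n t)\<bar> < e" if "n \<ge> n0" for n
    proof -
      have "(LINT t|?M. blinfun_apply (g t) (f n t)) - (LINT t|?M. blinfun_apply (r m t) (f n t))
          = (LINT t|?M. blinfun_apply (g t - r m t) (f n t))"
        by (subst Bochner_Integration.integral_diff[OF gf rf, symmetric]) (simp add: blinfun.diff_left)
      moreover have "integrable ?M (\<lambda>t. blinfun_apply (g t - r m t) (f n t))"
        unfolding blinfun.diff_left by (intro Bochner_Integration.integrable_diff gf rf)
      then have "\<bar>LINT t|?M. blinfun_apply (g t - r m t) (f n t)\<bar> \<le> (LINT t|?M. norm (g t - r m t))"
        by (intro order_trans[OF integral_abs_bound] integral_mono integrable_abs diff_int le)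
      ultimately show ?thesis using m n0[OF that] by linarith
    qed
    then show "\<exists>no. \<forall>n\<ge>no. norm ((LINT t|?M. blinfun_apply (g t) (f n t)) - 0) < e" by auto
  qed
qed

section \<open>Haar sums over dyadic trees of sets\<close>

text \<open>
  A sequence of turns is read from right to left, so that \<open>u @ s\<close> is a descendant of \<open>s\<close>; the turn
  \<open>False\<close> leads to the left. If the left half occupies the proportion \<open>p\<close> of a nonnull node,
  \<open>balanced\<close> says that \<open>p * (1 - p) \<ge> 2 / 9\<close>, which is equivalent to \<open>1 / 3 \<le> p \<le> 2 / 3\<close>.
\<close>

locale dyadic_tree = finite_measure M for M :: "'a measure" +
  fixes A :: "bool list \<Rightarrow> 'a set"
  assumes sets [measurable]: "A s \<in> sets M"
    and split: "A s = A (False # s) \<union> A (True # s)"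
    and disjoint: "A (False # s) \<inter> A (True # s) = {}"
    and balanced: "2 / 9 * measure M (A s) \<le> measure M (A (False # s)) * measure M (A (True # s)) / measure M (A s)"

text \<open>
  The value on each half is the proportion of the other half. This makes the integral of \<open>haar s\<close>
  zero and keeps its absolute value at most 1.
\<close>

definition (in dyadic_tree) left_weight :: "bool list \<Rightarrow> real" where
  "left_weight s = measure M (A (True # s)) / measure M (A s)"

definition (in dyadic_tree) right_weight :: "bool list \<Rightarrow> real" where
  "right_weight s = measure M (A (False # s)) / measure M (A s)"

definition (in dyadic_tree) haar :: "bool list \<Rightarrow> 'a \<Rightarrow> real" where
  "haar s t = left_weight s * indicator (A (False # s)) t - right_weight s * indicator (A (True # s)) t"

lemma (in dyadic_tree) weight_bounds: "0 \<le> left_weight s" "left_weight s \<le> 1" "0 \<le> right_weight s" "right_weight s \<le> 1"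
proof -
  have "A (i # s) \<subseteq> A s" for i using split[of s] by (cases i) auto
  then have "measure M (A (i # s)) \<le> measure M (A s)" for i
    by (intro finite_measure_mono) auto
  then show "0 \<le> left_weight s" "left_weight s \<le> 1" "0 \<le> right_weight s" "right_weight s \<le> 1"
    unfolding left_weight_def right_weight_def by (auto simp: divide_le_eq_1 zero_less_measure_iff)
qed

lemma (in dyadic_tree) haar_measurable [measurable]: "haar s \<in> borel_measurable M"
  unfolding haar_def[abs_def] by measurable

lemma (in dyadic_tree) abs_haar_le: "\<bar>haar s t\<bar> \<le> indicator (A s) t"
  using weight_bounds[of s] disjoint[of s] split[of s] by (auto simp: haar_def indicator_def)

lemma (in dyadic_tree) haar_outside: "t \<notin> A s \<Longrightarrow> haar s t = 0"
  using abs_haar_le[of s t] by simp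

lemma (in dyadic_tree) haar_integrable: "integrable M (haar s)"
proof (rule integrable_const_bound[of _ 1])
  show "AE t in M. norm (haar s t) \<le> 1"
    using order_trans[OF abs_haar_le] by (auto simp: indicator_def intro!: AE_I2)
qed measurable

lemma (in dyadic_tree) integrable_node [simp]: "integrable M (indicat_real (A s))"
  by (intro integrable_real_indicator) (auto simp: less_top[symmetric])

lemma (in dyadic_tree) integral_haar: "(LINT t|M. haar s t) = 0"
proof -
  have "(LINT t|M. haar s t)
      = left_weight s * measure M (A (False # s)) - right_weight s * measure M (A (True # s))"
    unfolding haar_def by (subst Bochner_Integration.integral_diff) auto
  then show ?thesis by (simp add: left_weight_def right_weight_def)
qed

lemma (in dyadic_tree) append_subset: "A (u @ s) \<subseteq> A s"
proof (induction u)
  case (Cons i u)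
  then show ?case using split[of "u @ s"] by (cases i) auto
qed simp

lemma (in dyadic_tree) level_disjoint: "length s = length r \<Longrightarrow> s \<noteq> r \<Longrightarrow> A s \<inter> A r = {}"
proof (induction s r rule: list_induct2)
  case (Cons i s j r)
  have sub: "A (i # s) \<subseteq> A s" "A (j # r) \<subseteq> A r" using append_subset[of "[i]" s] append_subset[of "[j]" r] by auto
  show ?case
  proof (cases "s = r")
    case True
    then have "i \<noteq> j" using Cons by auto
    with True show ?thesis using disjoint[of r] by (cases i; cases j) auto
  next
    case False
    then show ?thesis using Cons.IH sub by blast
  qed
qed simp

lemma (in dyadic_tree) level_cover: "t \<in> A [] \<Longrightarrow> \<exists>s. length s = n \<and> t \<in> A s"
proof (induction n)
  case (Suc n)
  then obtain s where "length s = n" "t \<in> A s" by blast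
  then show ?case using split[of s] by (metis UnE length_Cons)
qed auto

text \<open>
  The supports of two Haar functions of different levels are disjoint, or the finer support lies
  in one half of the coarser one. Together with \<open>integral_haar\<close> this gives orthogonality.
\<close>

lemma (in dyadic_tree) haar_constant: "length s < length r \<Longrightarrow> \<exists>c. \<forall>t\<in>A r. haar s t = c"
proof (induction r)
  case (Cons i r)
  have sub: "A (i # r) \<subseteq> A r" using append_subset[of "[i]" r] by auto
  consider "length s < length r" | "s = r" | "length s = length r" "s \<noteq> r" using Cons.prems by force
  then show ?case
  proof cases
    case 1
    with Cons.IH sub show ?thesis by blast
  next
    case 2
    have "\<forall>t\<in>A (i # r). haar s t = (if i then - right_weight s else left_weight s)"
      using disjoint[of s] 2 by (auto simp: haar_def indicator_def)
    then show ?thesis by blast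
  next
    case 3
    then have "\<forall>t\<in>A (i # r). haar s t = 0" using level_disjoint[OF 3] sub haar_outside by blast
    then show ?thesis by blast
  qed
qed simp

definition (in dyadic_tree) level :: "nat \<Rightarrow> bool list set" where
  "level n = {s. length s = n}"

lemma (in dyadic_tree) finite_level [simp]: "finite (level n)"
  using finite_lists_length_eq[of "UNIV :: bool set" n] by (simp add: level_def)

definition (in dyadic_tree) haar_sum :: "(bool list \<Rightarrow> 'x::real_normed_vector) \<Rightarrow> nat \<Rightarrow> 'a \<Rightarrow> 'x" where
  "haar_sum h n t = (\<Sum>s\<in>level n. haar s t *\<^sub>R h s)"

lemma (in dyadic_tree) haar_sum_on:
  assumes "t \<in> A s" "length s = n"
  shows "haar_sum h n t = haar s t *\<^sub>R h s"
proof -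
  have "haar_sum h n t = (\<Sum>r\<in>level n. if r = s then haar s t *\<^sub>R h s else 0)"
    unfolding haar_sum_def
  proof (rule sum.cong[OF refl])
    fix r assume "r \<in> level n"
    then have "t \<notin> A r" if "r \<noteq> s" using level_disjoint[of r s] that assms by (auto simp: level_def)
    then show "haar r t *\<^sub>R h r = (if r = s then haar s t *\<^sub>R h s else 0)" using haar_outside by auto
  qed
  also have "s \<in> level n" using assms by (simp add: level_def)
  then have "(\<Sum>r\<in>level n. if r = s then haar s t *\<^sub>R h s else 0) = haar s t *\<^sub>R h s"
    by (simp add: sum.delta)
  finally show ?thesis .
qed

lemma (in dyadic_tree) haar_sum_outside: "t \<notin> A [] \<Longrightarrow> haar_sum h n t = 0"
proof -
  assume "t \<notin> A []"
  then have "t \<notin> A s" for s using append_subset[of s "[]"] by auto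
  then show ?thesis by (simp add: haar_sum_def haar_outside)
qed

lemma (in dyadic_tree) norm_haar_sum_le:
  assumes "\<And>s. norm (h s) \<le> C"
  shows "norm (haar_sum h n t) \<le> C"
proof (cases "t \<in> A []")
  case True
  then obtain s where s: "length s = n" "t \<in> A s" using level_cover by blast
  have "norm (haar_sum h n t) = \<bar>haar s t\<bar> * norm (h s)" by (simp add: haar_sum_on[OF s(2,1)])
  also have "\<dots> \<le> 1 * C"
    using abs_haar_le[of s t] s(2) by (intro mult_mono assms) auto
  finally show ?thesis by simp
next
  case False
  then show ?thesis using order_trans[OF norm_ge_zero assms] by (simp add: haar_sum_outside)
qed

lemma (in dyadic_tree) simple_haar_sum: "simple_function M (haar_sum h n)"
proof -
  have "simple_function M (haar s)" for s
    unfolding haar_def[abs_def] by (intro simple_function_diff simple_function_mult) auto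
  then have "simple_function M (\<lambda>t. haar s t *\<^sub>R h s)" for s
    by (rule simple_function_compose1)
  then show ?thesis unfolding haar_sum_def[abs_def] by (intro simple_function_sum)
qed

lemma (in dyadic_tree) haar_sum_orthogonal:
  fixes a :: "bool list \<Rightarrow> real"
  assumes "m < n"
  shows "(LINT t|M. haar_sum a m t * haar_sum a n t) = 0"
proof -
  have zero: "(LINT t|M. haar s t * a s * (haar r t * a r)) = 0" and int: "integrable M (\<lambda>t. haar s t * a s * (haar r t * a r))"
    if "s \<in> level m" "r \<in> level n" for s r
  proof -
    have "length s < length r" using that assms by (simp add: level_def)
    from haar_constant[OF this] obtain c where "\<forall>t\<in>A r. haar s t = c" ..
    then have c: "haar s t = c" if "t \<in> A r" for t using that by (rule bspec)
    have eq: "haar s t * a s * (haar r t * a r) = c * a s * a r * haar r t" for t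
    proof (cases "t \<in> A r")
      case True
      show ?thesis unfolding c[OF True] by (simp only: mult_ac)
    qed (simp add: haar_outside)
    show "(LINT t|M. haar s t * a s * (haar r t * a r)) = 0"
      unfolding eq by (simp add: integral_haar)
    show "integrable M (\<lambda>t. haar s t * a s * (haar r t * a r))"
      unfolding eq using haar_integrable by simp
  qed
  have "(LINT t|M. haar_sum a m t * haar_sum a n t)
      = (LINT t|M. (\<Sum>s\<in>level m. \<Sum>r\<in>level n. haar s t * a s * (haar r t * a r)))"
    by (simp add: haar_sum_def sum_product)
  also have "\<dots> = (\<Sum>s\<in>level m. LINT t|M. (\<Sum>r\<in>level n. haar s t * a s * (haar r t * a r)))"
    by (intro Bochner_Integration.integral_sum Bochner_Integration.integrable_sum int)
  also have "\<dots> = (\<Sum>s\<in>level m. \<Sum>r\<in>level n. (LINT t|M. haar s t * a s * (haar r t * a r)))"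
    by (intro sum.cong refl Bochner_Integration.integral_sum int)
  also have "\<dots> = 0" by (intro sum.neutral ballI) (rule zero)
  finally show ?thesis .
qed

text \<open>
  Composition with a functional \<open>z\<close> turns \<open>haar_sum h n\<close> into a scalar Haar sum with bounded
  coefficients, and such sums are orthogonal for different levels.
\<close>

lemma (in dyadic_tree) haar_sum_weakly_null:
  fixes g :: "'a \<Rightarrow> 'x::real_normed_vector \<Rightarrow>\<^sub>L real"
  assumes h: "\<And>s. norm (h s) \<le> 1"
    and g: "strongly_measurable M g" "integrable (completion M) (\<lambda>t. norm (g t))"
  shows "(\<lambda>n. LINT t|completion M. blinfun_apply (g t) (haar_sum h n t)) \<longlonglongrightarrow> 0"
proof (rule weakly_null_functions[OF simple_haar_sum _ _ g])
  show "norm (haar_sum h n t) \<le> 1" for n t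
    using h by (rule norm_haar_sum_le)
  fix z :: "'x \<Rightarrow>\<^sub>L real" and B assume B: "B \<in> sets (completion M)"
  define a where "a s = blinfun_apply z (h s)" for s
  have eq: "blinfun_apply z (haar_sum h n t) = haar_sum a n t" for n t
    by (simp add: haar_sum_def a_def blinfun.sum_right blinfun.scaleR_right)
  have fin: "finite_measure (completion M)" by (rule finite_measureI) (simp add: emeasure_eq_measure)
  have a: "norm (a s) \<le> norm z" for s
    using norm_blinfun[of z "h s"] mult_left_mono[OF h[of s], of "norm z"] by (simp add: a_def)
  have meas: "haar_sum a n \<in> borel_measurable M" for n
    by (rule borel_measurable_simple_function[OF simple_haar_sum])
  show "(\<lambda>n. LINT t|completion M. indicator B t * blinfun_apply z (haar_sum h n t)) \<longlonglongrightarrow> 0"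
    unfolding eq
  proof (rule finite_measure.orthogonal_sequence_null[OF fin, where C = "norm z"])
    show "haar_sum a n \<in> borel_measurable (completion M)" for n
      by (rule measurable_completion[OF meas])
    show "\<bar>haar_sum a n t\<bar> \<le> norm z" for n t
      using norm_haar_sum_le[of a "norm z" n t] a by simp
    show "(LINT t|completion M. haar_sum a m t * haar_sum a n t) = 0" if "m < n" for m n
      using haar_sum_orthogonal[OF that, of a] meas by (subst integral_completion) auto
  qed (use B in \<open>auto simp: indicator_def\<close>)
qed

lemma tail_hull_simple_ball:
  fixes f :: "nat \<Rightarrow> 'a \<Rightarrow> 'x::real_normed_vector"
  assumes f: "\<And>n. simple_function M (f n)" "\<And>n t. norm (f n t) \<le> 1" and y: "y \<in> tail_hull f k"
  shows "simple_function M y \<and> (\<forall>t. norm (y t) \<le> 1)"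
  using y
proof induction
  case (generator n)
  then show ?case using f by blast
next
  case (midpoint y z)
  have "norm ((1/2) *\<^sub>R y t + (1/2) *\<^sub>R z t) \<le> 1" for t
  proof -
    have "norm ((1/2) *\<^sub>R y t + (1/2) *\<^sub>R z t) \<le> norm (y t) / 2 + norm (z t) / 2"
      using norm_triangle_ineq[of "(1/2) *\<^sub>R y t" "(1/2) *\<^sub>R z t"] by simp
    moreover have "norm (y t) \<le> 1" "norm (z t) \<le> 1" using midpoint.IH by auto
    ultimately show ?thesis by linarith
  qed
  moreover have "simple_function M (\<lambda>t. (1/2) *\<^sub>R y t + (1/2) *\<^sub>R z t)"
    using midpoint by (intro simple_function_compose2[where h = "\<lambda>a b. (1/2) *\<^sub>R a + (1/2) *\<^sub>R b"]) auto
  ultimately show ?case by blast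
qed

text \<open>
  Let \<open>G\<^sub>N y\<close> be the integral of \<open>\<langle>e\<^sub>r, y\<rangle>\<close>, where \<open>r\<close> is the node of level \<open>N\<close> that contains the
  point. For \<open>n < N\<close>, on the node \<open>A\<^sub>s\<close> of level \<open>n\<close> the integrand of \<open>G\<^sub>N (haar_sum h n)\<close>
  dominates \<open>c\<^sub>s haar\<^sub>s\<close>, with the additional gain \<open>\<epsilon> * left_weight s\<close> on the left half. The first
  part integrates to zero, and by \<open>balanced\<close> the gains add up to at least \<open>2 * \<epsilon> / 9\<close> times the
  measure of the root. The bound passes to convex combinations when \<open>N\<close> exceeds all levels
  involved, and \<open>G\<^sub>N y\<close> is at most \<open>L\<close> times the integral of \<open>norm y\<close>.
\<close>

lemma (in dyadic_tree) integral_haar_sum_lower_bound: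
  fixes h :: "bool list \<Rightarrow> 'x::real_normed_vector" and e :: "bool list \<Rightarrow> 'x \<Rightarrow>\<^sub>L real"
  assumes h: "\<And>s. norm (h s) \<le> 1" and e: "\<And>r. norm (e r) \<le> L" and "L > 0" "\<epsilon> \<ge> 0"
    and left: "\<And>u s. c s + \<epsilon> \<le> blinfun_apply (e (u @ False # s)) (h s)"
    and right: "\<And>u s. blinfun_apply (e (u @ True # s)) (h s) \<le> c s"
    and y: "y \<in> tail_hull (haar_sum h) 0"
  shows "2 * \<epsilon> / 9 * measure M (A []) / L \<le> (LINT t|M. norm (y t))"
proof -
  define G where "G N y = (LINT t|M. (\<Sum>r\<in>level N. indicator (A r) t * blinfun_apply (e r) (y t)))"
    for N and y :: "'a \<Rightarrow> 'x"
  define \<kappa> where "\<kappa> = 2 * \<epsilon> / 9 * measure M (A [])"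
  have G_on: "(\<Sum>r\<in>level N. indicator (A r) t * blinfun_apply (e r) x) = blinfun_apply (e s) x"
    if "t \<in> A s" "s \<in> level N" for N t s and x :: 'x
  proof -
    have "(\<Sum>r\<in>level N. indicator (A r) t * blinfun_apply (e r) x)
        = (\<Sum>r\<in>level N. if r = s then blinfun_apply (e s) x else 0)"
    proof (rule sum.cong[OF refl])
      fix r assume "r \<in> level N"
      then show "indicator (A r) t * blinfun_apply (e r) x = (if r = s then blinfun_apply (e s) x else 0)"
        using level_disjoint[of r s] that by (cases "r = s") (auto simp: level_def indicator_def)
    qed
    then show ?thesis using that by (simp add: sum.delta)
  qed
  have G_off: "(\<Sum>r\<in>level N. indicator (A r) t * blinfun_apply (e r) x) = 0" if "t \<notin> A []" for N t and x :: 'x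
    using append_subset[of _ "[]"] that by (intro sum.neutral) (auto simp: subset_iff indicator_def)
  have in_ball: "simple_function M y \<and> (\<forall>t. norm (y t) \<le> 1)" if "y \<in> tail_hull (haar_sum h) k" for y k
    by (rule tail_hull_simple_ball[OF simple_haar_sum norm_haar_sum_le that]) (rule h)
  have G_abs: "\<bar>\<Sum>r\<in>level N. indicator (A r) t * blinfun_apply (e r) x\<bar> \<le> L * norm x" for N t and x :: 'x
  proof (cases "t \<in> A []")
    case True
    then obtain s where s: "s \<in> level N" "t \<in> A s" using level_cover[of t N] by (auto simp: level_def)
    have "\<bar>blinfun_apply (e s) x\<bar> \<le> norm (e s) * norm x" using norm_blinfun[of "e s" x] by simp
    also have "\<dots> \<le> L * norm x" by (intro mult_right_mono e) auto
    finally show ?thesis unfolding G_on[OF s(2,1)] .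
  next
    case False
    show ?thesis unfolding G_off[OF False] using \<open>L > 0\<close> by simp
  qed
  have G_int: "integrable M (\<lambda>t. \<Sum>r\<in>level N. indicator (A r) t * blinfun_apply (e r) (y t))"
    and norm_int: "integrable M (\<lambda>t. norm (y t))" if y: "simple_function M y" "\<forall>t. norm (y t) \<le> 1" for N y
  proof -
    have "L * norm (y t) \<le> L" for t using y(2) \<open>L > 0\<close> by simp
    then show "integrable M (\<lambda>t. \<Sum>r\<in>level N. indicator (A r) t * blinfun_apply (e r) (y t))"
    proof (intro integrable_const_bound[of _ L])
      have "simple_function M (\<lambda>t. \<Sum>r\<in>level N. indicator (A r) t * blinfun_apply (e r) (y t))"
        by (intro simple_function_sum simple_function_mult simple_function_indicator sets simple_function_compose1[OF y(1)])
      then show "(\<lambda>t. \<Sum>r\<in>level N. indicator (A r) t * blinfun_apply (e r) (y t)) \<in> borel_measurable M"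
        by (rule borel_measurable_simple_function)
    qed (use order_trans[OF G_abs] in auto)
    show "integrable M (\<lambda>t. norm (y t))"
      using y by (intro integrable_const_bound[of _ 1] borel_measurable_simple_function simple_function_compose1[OF y(1)]) auto
  qed
  have G_le: "G N y \<le> L * (LINT t|M. norm (y t))" if y: "simple_function M y" "\<forall>t. norm (y t) \<le> 1" for N y
  proof -
    have "G N y \<le> (LINT t|M. L * norm (y t))"
      unfolding G_def using abs_le_D1[OF G_abs] by (intro integral_mono G_int[OF y] integrable_mult_right norm_int[OF y])
    then show ?thesis by simp
  qed
  have G_haar: "\<kappa> \<le> G N (haar_sum h n)" if "n < N" for n N
  proof -
    \<comment> \<open>a minorant of the integrand of \<open>G N (haar_sum h n)\<close>\<close>
    define k where "k t = (\<Sum>s\<in>level n. c s * haar s t + \<epsilon> * left_weight s * indicator (A (False # s)) t)" for t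
    have "2 / 9 * measure M (A []) \<le> (\<Sum>s\<in>level n. left_weight s * measure M (A (False # s)))"
    proof -
      have "measure M (A []) \<le> measure M (\<Union>s\<in>level n. A s)"
        using level_cover[of _ n] by (intro finite_measure_mono) (auto simp: level_def intro!: sets.finite_UN)
      also have "\<dots> \<le> (\<Sum>s\<in>level n. measure M (A s))"
        by (intro measure_UNION_le) auto
      finally have "2 / 9 * measure M (A []) \<le> 2 / 9 * (\<Sum>s\<in>level n. measure M (A s))" by simp
      also have "\<dots> = (\<Sum>s\<in>level n. 2 / 9 * measure M (A s))" by (rule sum_distrib_left)
      also have "\<dots> \<le> (\<Sum>s\<in>level n. left_weight s * measure M (A (False # s)))"
        using balanced by (intro sum_mono) (simp add: left_weight_def mult.commute)
      finally show ?thesis .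
    qed
    then have "\<kappa> \<le> \<epsilon> * (\<Sum>s\<in>level n. left_weight s * measure M (A (False # s)))"
      using mult_left_mono[OF _ \<open>\<epsilon> \<ge> 0\<close>] by (fastforce simp: \<kappa>_def)
    also have "\<dots> = (\<Sum>s\<in>level n. LINT t|M. c s * haar s t + \<epsilon> * left_weight s * indicator (A (False # s)) t)"
    proof -
      have "(LINT t|M. c s * haar s t + \<epsilon> * left_weight s * indicator (A (False # s)) t)
          = \<epsilon> * (left_weight s * measure M (A (False # s)))" for s
        using haar_integrable[of s] integral_haar[of s] by (subst Bochner_Integration.integral_add) auto
      then show ?thesis by (simp add: sum_distrib_left)
    qed
    also have "\<dots> = (LINT t|M. k t)"
      unfolding k_def using haar_integrable
      by (intro Bochner_Integration.integral_sum[symmetric] Bochner_Integration.integrable_add) auto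
    also have "\<dots> \<le> G N (haar_sum h n)"
      unfolding G_def
    proof (rule integral_mono)
      show "integrable M k" unfolding k_def[abs_def] using haar_integrable by auto
      show "integrable M (\<lambda>t. \<Sum>r\<in>level N. indicator (A r) t * blinfun_apply (e r) (haar_sum h n t))"
        using in_ball[OF tail_hull.generator[of n n]] by (intro G_int) auto
      fix t
      show "k t \<le> (\<Sum>r\<in>level N. indicator (A r) t * blinfun_apply (e r) (haar_sum h n t))"
      proof (cases "t \<in> A []")
        case False
        then have "t \<notin> A s" for s using append_subset[of s "[]"] by auto
        then show ?thesis using False by (simp add: G_off k_def haar_outside)
      next
        case True
        then obtain r where r: "r \<in> level N" "t \<in> A r" using level_cover[of t N] by (auto simp: level_def)
        \<comment> \<open>\<open>s\<close> is the ancestor of \<open>r\<close> at level \<open>n\<close>, and \<open>r ! j\<close> is the turn taken there.\<close>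
        define j where "j = N - Suc n"
        define s where "s = drop (Suc j) r"
        have j: "j < length r" using r \<open>n < N\<close> by (simp add: j_def level_def)
        have r_eq: "r = take j r @ r ! j # s" unfolding s_def by (rule id_take_nth_drop[OF j])
        have s: "s \<in> level n" using r \<open>n < N\<close> by (simp add: s_def j_def level_def)
        have ts': "t \<in> A (r ! j # s)" using r(2) append_subset[of "take j r" "r ! j # s"] r_eq by auto
        then have ts: "t \<in> A s" using append_subset[of "[r ! j]" s] by auto
        have "k t = (\<Sum>s'\<in>level n. if s' = s then c s * haar s t + \<epsilon> * left_weight s * indicator (A (False # s)) t else 0)"
          unfolding k_def
        proof (rule sum.cong[OF refl])
          fix s' assume "s' \<in> level n"
          then have "t \<notin> A s'" if "s' \<noteq> s" using level_disjoint[of s' s] that ts s by (auto simp: level_def)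
          moreover have "A (False # s') \<subseteq> A s'" using append_subset[of "[False]" s'] by simp
          ultimately show "c s' * haar s' t + \<epsilon> * left_weight s' * indicator (A (False # s')) t
              = (if s' = s then c s * haar s t + \<epsilon> * left_weight s * indicator (A (False # s)) t else 0)"
            by (auto simp: haar_outside indicator_def)
        qed
        also have "\<dots> = c s * haar s t + \<epsilon> * left_weight s * indicator (A (False # s)) t"
          using s by (simp add: sum.delta)
        also have "\<dots> \<le> haar s t * blinfun_apply (e r) (h s)"
        proof (cases "r ! j")
          case False
          then have "haar s t = left_weight s" "t \<in> A (False # s)" using ts' disjoint[of s] by (auto simp: haar_def indicator_def)
          moreover have "left_weight s * (c s + \<epsilon>) \<le> left_weight s * blinfun_apply (e r) (h s)"
            using left[of s "take j r"] r_eq False weight_bounds[of s] by (intro mult_left_mono) auto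
          ultimately show ?thesis by (simp add: algebra_simps)
        next
          case True
          then have "haar s t = - right_weight s" "t \<notin> A (False # s)" using ts' disjoint[of s] by (auto simp: haar_def indicator_def)
          moreover have "right_weight s * blinfun_apply (e r) (h s) \<le> right_weight s * c s"
            using right[of "take j r" s] r_eq True weight_bounds[of s] by (intro mult_left_mono) auto
          ultimately show ?thesis by (simp add: algebra_simps)
        qed
        also have "\<dots> = blinfun_apply (e r) (haar_sum h n t)"
          using s by (subst haar_sum_on[OF ts]) (auto simp: level_def blinfun.scaleR_right)
        also have "\<dots> = (\<Sum>r\<in>level N. indicator (A r) t * blinfun_apply (e r) (haar_sum h n t))"
          by (rule G_on[OF r(2,1), symmetric])
        finally show ?thesis .
      qed
    qed
    finally show ?thesis .
  qed
  have "\<exists>N0. \<forall>N\<ge>N0. \<kappa> \<le> G N y"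
    using y
  proof induction
    case (generator n)
    then show ?case using G_haar by (intro exI[of _ "Suc n"]) auto
  next
    case (midpoint y z)
    then obtain N1 N2 where N: "\<And>N. N \<ge> N1 \<Longrightarrow> \<kappa> \<le> G N y" "\<And>N. N \<ge> N2 \<Longrightarrow> \<kappa> \<le> G N z" by blast
    have "G N (\<lambda>t. (1/2) *\<^sub>R y t + (1/2) *\<^sub>R z t) = (1/2) * G N y + (1/2) * G N z" for N
    proof -
      have "G N (\<lambda>t. (1/2) *\<^sub>R y t + (1/2) *\<^sub>R z t)
        = (LINT t|M. (1/2) * (\<Sum>r\<in>level N. indicator (A r) t * blinfun_apply (e r) (y t))
          + (1/2) * (\<Sum>r\<in>level N. indicator (A r) t * blinfun_apply (e r) (z t)))"
        unfolding G_def by (intro Bochner_Integration.integral_cong refl)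
          (simp only: blinfun.add_right blinfun.scaleR_right real_scaleR_def distrib_left sum.distrib sum_distrib_left mult_ac)
      also have "\<dots> = (1/2) * G N y + (1/2) * G N z"
      proof -
        have "integrable M (\<lambda>t. (1/2) * (\<Sum>r\<in>level N. indicator (A r) t * blinfun_apply (e r) (x t)))"
          if "x \<in> tail_hull (haar_sum h) 0" for x
          using in_ball[OF that] by (intro integrable_mult_right G_int) blast+
        from Bochner_Integration.integral_add[OF this[OF midpoint(1)] this[OF midpoint(2)]]
        show ?thesis unfolding G_def by (simp only: integral_mult_right_zero)
      qed
      finally show ?thesis .
    qed
    moreover have "\<kappa> \<le> (1/2) * G N y + (1/2) * G N z" if "N \<ge> max N1 N2" for N
      using N(1)[of N] N(2)[of N] that by simp
    ultimately show ?case by (intro exI[of _ "max N1 N2"]) simp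
  qed
  then obtain N where "\<kappa> \<le> G N y" by blast
  also have "\<dots> \<le> L * (LINT t|M. norm (y t))" using in_ball[OF y] by (intro G_le) auto
  finally show ?thesis using \<open>L > 0\<close> by (simp add: \<kappa>_def field_simps)
qed

lemma (in finite_measure) exists_dyadic_tree:
  assumes A0: "A0 \<in> sets M" and na: "\<And>B. B \<subseteq> A0 \<Longrightarrow> \<not> atom M B"
  shows "\<exists>A. dyadic_tree M A \<and> A [] = A0"
proof -
  define part where "part X = (SOME B. B \<in> sets M \<and> B \<subseteq> X \<and>
    measure M X / 3 \<le> measure M B \<and> measure M B \<le> 2 * measure M X / 3)" for X
  have part: "part X \<in> sets M \<and> part X \<subseteq> X \<and>
      measure M X / 3 \<le> measure M (part X) \<and> measure M (part X) \<le> 2 * measure M X / 3"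
    if "X \<in> sets M" "X \<subseteq> A0" for X
  proof -
    have "\<exists>B\<in>sets M. B \<subseteq> X \<and> measure M X / 3 \<le> measure M B \<and> measure M B \<le> 2 * measure M X / 3"
      using that na by (intro split_atomless) auto
    then show ?thesis unfolding part_def Bex_def by (rule someI_ex)
  qed
  define A where "A = rec_list A0 (\<lambda>i _ X. if i then X - part X else part X)"
  have A_Nil: "A [] = A0" and A_Cons: "A (i # s) = (if i then A s - part (A s) else part (A s))" for i s
    by (simp_all add: A_def)
  have A: "A s \<in> sets M \<and> A s \<subseteq> A0" for s
  proof (induction s)
    case (Cons i s)
    then show ?case using part[of "A s"] by (auto simp: A_Cons)
  qed (simp add: A_Nil A0)
  have "dyadic_tree M A"
  proof
    fix s
    show "A s \<in> sets M" using A by blast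
    have p: "part (A s) \<in> sets M" "part (A s) \<subseteq> A s"
      "measure M (A s) / 3 \<le> measure M (part (A s))" "measure M (part (A s)) \<le> 2 * measure M (A s) / 3"
      using part[of "A s"] A[of s] by blast+
    show "A s = A (False # s) \<union> A (True # s)" "A (False # s) \<inter> A (True # s) = {}"
      using p(2) by (auto simp: A_Cons)
    show "2 / 9 * measure M (A s) \<le> measure M (A (False # s)) * measure M (A (True # s)) / measure M (A s)"
    proof (cases "measure M (A s) = 0")
      case False
      define m b where "m = measure M (A s)" and "b = measure M (part (A s))"
      have "m > 0" using False by (simp add: m_def zero_less_measure_iff)
      have "measure M (A s - part (A s)) = m - b"
        unfolding m_def b_def using p A by (intro finite_measure_Diff) auto
      moreover have "0 \<le> (b - m / 3) * (2 * m / 3 - b)" using p(3,4) by (simp add: m_def b_def)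
      moreover have "(b - m / 3) * (2 * m / 3 - b) = b * (m - b) - 2 / 9 * m * m" by (simp add: field_simps)
      ultimately show ?thesis
        using \<open>m > 0\<close> by (simp add: A_Cons m_def[symmetric] b_def[symmetric] pos_le_divide_eq)
    qed simp
  qed
  with A_Nil show ?thesis by blast
qed

section \<open>Trees from the failure of the Radon-Nikodym property\<close>

text \<open>
  Start with \<open>B\<close> and apply \<open>separating_vector\<close> to each node \<open>D\<^sub>s\<close> in turn, with the two sets it
  provides as the children. The functional \<open>e\<^sub>r\<close> is the average of \<open>F\<close> over \<open>D\<^sub>r\<close>. As \<open>D\<^sub>r\<close> is
  contained in one of the two children of each ancestor \<open>D\<^sub>s\<close>, and the inequalities for \<open>h\<^sub>s\<close> are
  inherited by subsets, they hold for \<open>e\<^sub>r\<close>.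
\<close>

lemma (in finite_measure) separating_tree:
  fixes F :: "'a set \<Rightarrow> 'x::real_normed_vector \<Rightarrow>\<^sub>L real"
  assumes F: "vector_measure M F" and null: "\<And>A. A \<in> sets M \<Longrightarrow> measure M A = 0 \<Longrightarrow> F A = 0"
    and B: "B \<in> sets M" "measure M B > 0" and "\<epsilon> \<ge> 0"
    and bound: "\<And>A. A \<in> sets M \<Longrightarrow> A \<subseteq> B \<Longrightarrow> norm (F A) \<le> L * measure M A"
    and far: "\<And>C. C \<in> sets M \<Longrightarrow> C \<subseteq> B \<Longrightarrow> measure M C > 0 \<Longrightarrow>
      \<exists>A\<in>sets M. A \<subseteq> C \<and> norm (F A - (measure M A / measure M C) *\<^sub>R F C) > \<epsilon> * measure M A"
  shows "\<exists>h c (e :: bool list \<Rightarrow> 'x \<Rightarrow>\<^sub>L real). (\<forall>s. norm (h s) \<le> 1) \<and> (\<forall>s. norm (e s) \<le> L) \<and>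
    (\<forall>u s. c s + \<epsilon> \<le> blinfun_apply (e (u @ False # s)) (h s)) \<and>
    (\<forall>u s. blinfun_apply (e (u @ True # s)) (h s) \<le> c s)"
proof -
  define good where "good C h c C0 C1 \<longleftrightarrow> norm h \<le> 1 \<and>
    C0 \<in> sets M \<and> C0 \<subseteq> C \<and> measure M C0 > 0 \<and>
      (\<forall>B\<in>sets M. B \<subseteq> C0 \<longrightarrow> (c + \<epsilon>) * measure M B \<le> blinfun_apply (F B) h) \<and>
    C1 \<in> sets M \<and> C1 \<subseteq> C \<and> measure M C1 > 0 \<and>
      (\<forall>B\<in>sets M. B \<subseteq> C1 \<longrightarrow> blinfun_apply (F B) h \<le> c * measure M B)" for C h c C0 C1
  have "\<exists>h c C0 C1. good C h c C0 C1"
    if C: "C \<in> sets M" "C \<subseteq> B" "measure M C > 0" for C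
  proof -
    obtain A where "A \<in> sets M" "A \<subseteq> C" "norm (F A - (measure M A / measure M C) *\<^sub>R F C) > \<epsilon> * measure M A"
      using far[OF C] by blast
    from separating_vector[OF F null C(1,3) this(1,2) \<open>\<epsilon> \<ge> 0\<close> this(3)] show ?thesis unfolding good_def .
  qed
  then obtain hh cc c0 c1 where good: "\<And>C. C \<in> sets M \<Longrightarrow> C \<subseteq> B \<Longrightarrow> measure M C > 0 \<Longrightarrow>
      good C (hh C) (cc C) (c0 C) (c1 C)" by metis
  define D where "D = rec_list B (\<lambda>i _ C. if i then c1 C else c0 C)"
  have D_Nil: "D [] = B" and D_Cons: "D (i # s) = (if i then c1 (D s) else c0 (D s))" for i s
    by (simp_all add: D_def)
  have D: "D s \<in> sets M \<and> D s \<subseteq> B \<and> measure M (D s) > 0" for s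
  proof (induction s)
    case (Cons i s)
    then have "good (D s) (hh (D s)) (cc (D s)) (c0 (D s)) (c1 (D s))" by (intro good) auto
    then show ?case using Cons unfolding good_def by (auto simp: D_Cons)
  qed (simp add: D_Nil B)
  have gD: "good (D s) (hh (D s)) (cc (D s)) (c0 (D s)) (c1 (D s))" for s using D by (intro good) auto
  have sub: "D (u @ s) \<subseteq> D s" for u s
  proof (induction u)
    case (Cons i u)
    then show ?case using gD[of "u @ s"] unfolding good_def by (auto simp: D_Cons)
  qed simp
  define e where "e s = (1 / measure M (D s)) *\<^sub>R F (D s)" for s
  have "norm (e s) \<le> L" for s
    using bound[of "D s"] D[of s] by (simp add: e_def pos_divide_le_eq)
  moreover have "norm (hh (D s)) \<le> 1" for s using gD[of s] by (simp add: good_def)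
  moreover have "cc (D s) + \<epsilon> \<le> blinfun_apply (e (u @ False # s)) (hh (D s))" for u s
  proof -
    have "(cc (D s) + \<epsilon>) * measure M (D (u @ False # s)) \<le> blinfun_apply (F (D (u @ False # s))) (hh (D s))"
      using gD[of s] sub[of u "False # s"] D[of "u @ False # s"] unfolding good_def by (auto simp: D_Cons)
    then show ?thesis using D[of "u @ False # s"] by (simp add: e_def blinfun.scaleR_left pos_le_divide_eq)
  qed
  moreover have "blinfun_apply (e (u @ True # s)) (hh (D s)) \<le> cc (D s)" for u s
  proof -
    have "blinfun_apply (F (D (u @ True # s))) (hh (D s)) \<le> cc (D s) * measure M (D (u @ True # s))"
      using gD[of s] sub[of u "True # s"] D[of "u @ True # s"] unfolding good_def by (auto simp: D_Cons)
    then show ?thesis using D[of "u @ True # s"] by (simp add: e_def blinfun.scaleR_left pos_divide_le_eq)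
  qed
  ultimately show ?thesis
    by (intro exI[of _ "\<lambda>s. hh (D s)"] exI[of _ "\<lambda>s. cc (D s)"] exI[of _ e]) blast
qed

lemma not_radon_nikodym_tree:
  assumes "\<not> radon_nikodym_property TYPE('b) TYPE('x::real_normed_vector \<Rightarrow>\<^sub>L real)"
  shows "\<exists>(h :: bool list \<Rightarrow> 'x) c (e :: bool list \<Rightarrow> 'x \<Rightarrow>\<^sub>L real) \<epsilon> L. \<epsilon> > 0 \<and> L > 0 \<and>
    (\<forall>s. norm (h s) \<le> 1) \<and> (\<forall>s. norm (e s) \<le> L) \<and>
    (\<forall>u s. c s + \<epsilon> \<le> blinfun_apply (e (u @ False # s)) (h s)) \<and>
    (\<forall>u s. blinfun_apply (e (u @ True # s)) (h s) \<le> c s)"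
proof -
  from assms obtain M :: "'b measure" and F :: "'b set \<Rightarrow> 'x \<Rightarrow>\<^sub>L real" where
    M: "finite_measure M" and F: "vector_measure M F" and bv: "bounded_variation M F"
    and ac: "continuous_wrt_measure M F"
    and no: "\<not> (\<exists>g. \<forall>A\<in>sets M. has_strong_bochner_integral M (\<lambda>x. indicator A x *\<^sub>R g x) (F A))"
    unfolding radon_nikodym_property_def by blast
  interpret finite_measure M by fact
  have null: "F A = 0" if "A \<in> sets M" "measure M A = 0" for A
    using continuous_wrt_measure_null[OF ac that] .
  obtain \<epsilon> where \<epsilon>: "\<epsilon> > 0" and "\<not> (\<forall>B\<in>sets M. B \<subseteq> space M \<longrightarrow> measure M B > 0 \<longrightarrow>
      (\<exists>C\<in>sets M. C \<subseteq> B \<and> measure M C > 0 \<and>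
      (\<forall>A\<in>sets M. A \<subseteq> C \<longrightarrow> norm (F A - (measure M A / measure M C) *\<^sub>R F C) \<le> \<epsilon> * measure M A)))"
    using density_of_small_oscillation[OF F ac bv] no by blast
  then obtain B where B: "B \<in> sets M" "measure M B > 0" and far: "\<And>C. C \<in> sets M \<Longrightarrow> C \<subseteq> B \<Longrightarrow> measure M C > 0 \<Longrightarrow>
      \<exists>A\<in>sets M. A \<subseteq> C \<and> norm (F A - (measure M A / measure M C) *\<^sub>R F C) > \<epsilon> * measure M A"
    by (auto simp: not_le)
  obtain C L where C: "C \<in> sets M" "C \<subseteq> B" "measure M C > 0" "L > 0"
    "\<And>A. A \<in> sets M \<Longrightarrow> A \<subseteq> C \<Longrightarrow> norm (F A) \<le> L * measure M A"
    using bounded_density_subset[OF F null bv B] by blast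
  have "\<exists>h c (e :: bool list \<Rightarrow> 'x \<Rightarrow>\<^sub>L real). (\<forall>s. norm (h s) \<le> 1) \<and> (\<forall>s. norm (e s) \<le> L) \<and>
    (\<forall>u s. c s + \<epsilon> \<le> blinfun_apply (e (u @ False # s)) (h s)) \<and>
    (\<forall>u s. blinfun_apply (e (u @ True # s)) (h s) \<le> c s)"
    using \<epsilon> C by (intro separating_tree[OF F null C(1,3)] far) auto
  with \<epsilon> \<open>L > 0\<close> show ?thesis by blast
qed

section \<open>Koethe-Bochner spaces\<close>

lemma (in kothe_function_space) bounded_mem:
  assumes "f \<in> borel_measurable (completion M)" "\<And>x. \<bar>f x\<bar> \<le> c"
  shows "f \<in> E" and "N f \<le> c * N (indicator (space M))"
proof -
  have c: "c \<ge> 0" using assms(2)[of undefined] by linarith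
  have e: "(\<lambda>x. c * indicat_real (space M) x) \<in> E" by (intro scale_closed indicator) simp
  have ae: "AE x in M. \<bar>f x\<bar> \<le> \<bar>c * indicat_real (space M) x\<bar>"
    using assms(2) c by (intro AE_I2) auto
  show "f \<in> E" by (rule solid[OF assms(1) e ae])
  have "N f \<le> N (\<lambda>x. c * indicat_real (space M) x)" by (rule norm_mono[OF assms(1) e ae])
  also have "\<dots> = c * N (indicator (space M))" using c by (subst norm_scale) (auto intro: indicator)
  finally show "N f \<le> c * N (indicator (space M))" .
qed

lemma (in kothe_function_space) bochner_add:
  assumes "f \<in> kothe_bochner M E" "g \<in> kothe_bochner M E"
  shows "(\<lambda>x. f x + g x) \<in> kothe_bochner M E"
    and "kothe_bochner_norm N (\<lambda>x. f x + g x) \<le> kothe_bochner_norm N f + kothe_bochner_norm N g"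
proof -
  have fg: "strongly_measurable M f" "strongly_measurable M g" "(\<lambda>x. norm (f x)) \<in> E" "(\<lambda>x. norm (g x)) \<in> E"
    using assms by (auto simp: kothe_bochner_def)
  then have sm: "strongly_measurable M (\<lambda>x. f x + g x)" by (intro strongly_measurable_add)
  have e: "(\<lambda>x. norm (f x) + norm (g x)) \<in> E" using fg by (intro add_closed)
  have ae: "AE x in M. \<bar>norm (f x + g x)\<bar> \<le> \<bar>norm (f x) + norm (g x)\<bar>"
    by (intro AE_I2) (simp add: norm_triangle_ineq)
  show "(\<lambda>x. f x + g x) \<in> kothe_bochner M E"
    using sm solid[OF strongly_measurable_norm[OF sm] e ae] by (simp add: kothe_bochner_def)
  show "kothe_bochner_norm N (\<lambda>x. f x + g x) \<le> kothe_bochner_norm N f + kothe_bochner_norm N g"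
    unfolding kothe_bochner_norm_def
    using norm_mono[OF strongly_measurable_norm[OF sm] e ae] norm_triangle[OF fg(3,4)] by simp
qed

lemma (in kothe_function_space) bochner_scaleR:
  assumes "f \<in> kothe_bochner M E"
  shows "(\<lambda>x. c *\<^sub>R f x) \<in> kothe_bochner M E"
    and "kothe_bochner_norm N (\<lambda>x. c *\<^sub>R f x) = \<bar>c\<bar> * kothe_bochner_norm N f"
  using assms scale_closed[of "\<lambda>x. norm (f x)" "\<bar>c\<bar>"] norm_scale[of "\<lambda>x. norm (f x)" "\<bar>c\<bar>"]
  by (auto simp: kothe_bochner_def kothe_bochner_norm_def strongly_measurable_scaleR)

lemma (in kothe_function_space) bochner_bounded_mem:
  assumes "strongly_measurable M f" "\<And>x. norm (f x) \<le> c"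
  shows "f \<in> kothe_bochner M E" and "kothe_bochner_norm N f \<le> c * N (indicator (space M))"
  using assms bounded_mem[OF strongly_measurable_norm[OF assms(1)], of c]
  by (auto simp: kothe_bochner_def kothe_bochner_norm_def)

text \<open>
  The completeness of \<open>E(X)\<close> in the one case in which it is needed. The partial sums are simple
  and converge uniformly, which gives strong measurability of the sum and convergence in norm at
  the same time.
\<close>

lemma (in kothe_function_space) bochner_geometric_series:
  fixes y :: "nat \<Rightarrow> 'a \<Rightarrow> 'x::banach"
  assumes y: "\<And>i. simple_function M (y i)" "\<And>i t. norm (y i t) \<le> 1"
  shows "\<exists>g\<in>kothe_bochner M E.
    (\<lambda>n. kothe_bochner_norm N (\<lambda>t. g t - (\<Sum>i<n. (1/2) ^ Suc i *\<^sub>R y i t))) \<longlonglongrightarrow> 0"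
proof -
  define v where "v n t = (\<Sum>i<n. (1/2) ^ Suc i *\<^sub>R y i t)" for n t
  define g where "g t = (\<Sum>i. (1/2) ^ Suc i *\<^sub>R y i t)" for t
  have le: "norm ((1/2) ^ Suc i *\<^sub>R y i t) \<le> (1/2) ^ Suc i" for i t
    using mult_left_mono[OF y(2), of "(1/2) ^ Suc i" i t] by simp
  have summ: "summable (\<lambda>i. (1/2) ^ Suc i *\<^sub>R y i t)" for t
    by (rule summable_comparison_test'[OF sums_summable[OF power_half_series] le])
  have tail: "norm (g t - v n t) \<le> (1/2) ^ n" for n t
  proof -
    have "g t - v n t = (\<Sum>i. (1/2) ^ Suc (i + n) *\<^sub>R y (i + n) t)"
      unfolding g_def v_def using suminf_minus_initial_segment[OF summ, of n t] by simp
    also have "norm \<dots> \<le> (1/2) ^ n"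
    proof -
      have s: "(\<lambda>i. (1/2::real) ^ Suc (i + n)) sums (1/2) ^ n"
        using sums_mult[OF power_half_series, of "(1/2) ^ n"] by (simp add: power_add mult_ac)
      have "norm (\<Sum>i. (1/2) ^ Suc (i + n) *\<^sub>R y (i + n) t) \<le> (\<Sum>i. (1/2::real) ^ Suc (i + n))"
        by (rule norm_suminf_le[OF le sums_summable[OF s]])
      then show ?thesis using sums_unique[OF s] by simp
    qed
    finally show ?thesis .
  qed
  have v_simple: "simple_function M (v n)" for n
    unfolding v_def[abs_def] by (intro simple_function_sum simple_function_compose1[OF y(1)])
  have "(\<lambda>n. v n t) \<longlonglongrightarrow> g t" for t
    unfolding v_def g_def by (rule summable_LIMSEQ[OF summ])
  then have g_sm: "strongly_measurable M g"
    unfolding strongly_measurable_def using v_simple by (intro exI[of _ v]) auto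
  have "norm (g t) \<le> 1" for t using tail[of t 0] by (simp add: v_def)
  then have gV: "g \<in> kothe_bochner M E" by (rule bochner_bounded_mem(1)[OF g_sm])
  have sm: "strongly_measurable M (\<lambda>t. g t - v n t)" for n
    using strongly_measurable_add[OF g_sm strongly_measurable_scaleR[OF strongly_measurable_simple[OF v_simple[of n]], of "-1"]]
    by simp
  have "(\<lambda>n. kothe_bochner_norm N (\<lambda>t. g t - v n t)) \<longlonglongrightarrow> 0"
  proof (rule Lim_null_comparison)
    have "0 \<le> kothe_bochner_norm N (\<lambda>t. g t - v n t)" for n
    proof -
      have m: "(\<lambda>t. g t - v n t) \<in> kothe_bochner M E" by (rule bochner_bounded_mem(1)[OF sm tail])
      have "kothe_bochner_norm N (\<lambda>t. 0 *\<^sub>R (g t - v n t)) = 0" using bochner_scaleR(2)[OF m, of 0] by simp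
      then show ?thesis
        using bochner_add(2)[OF m bochner_scaleR(1)[OF m, of "-1"]] bochner_scaleR(2)[OF m, of "-1"] by simp
    qed
    then show "\<forall>\<^sub>F n in sequentially. norm (kothe_bochner_norm N (\<lambda>t. g t - v n t))
        \<le> (1/2) ^ n * N (indicator (space M))"
      using bochner_bounded_mem(2)[OF sm tail] by simp
    show "(\<lambda>n. (1/2) ^ n * N (indicator (space M))) \<longlonglongrightarrow> 0"
      by (intro tendsto_mult_left_zero LIMSEQ_power_zero) simp
  qed
  with gV show ?thesis unfolding v_def by blast
qed

text \<open>
  A lower estimate of the norm of \<open>E\<close> by that of \<open>L\<^sub>1\<close>, on a part of \<open>A\<close>. Take \<open>g\<close> that attains
  the norm of the function with value \<open>x0\<close> on \<open>A\<close> and 0 elsewhere, and let \<open>w = \<langle>g, x0\<rangle>\<close>. The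
  integral of \<open>w\<close> over \<open>A\<close> is positive, so \<open>w\<close> exceeds some \<open>1 / (n + 1)\<close> on a nonnull part \<open>B\<close> of
  \<open>A\<close>; as \<open>g\<close> belongs to the dual unit ball, the integral of \<open>u w\<close> is at most \<open>norm x0 * N u\<close>.
\<close>

lemma (in kothe_function_space) boundary_lower_bound:
  fixes x0 :: "'x::real_normed_vector" and H :: "('a \<Rightarrow> 'x \<Rightarrow>\<^sub>L real) set"
  assumes bd: "james_boundary (kothe_bochner M E) (kothe_bochner_norm N)
      (kothe_bochner_functional M ` H)" and H: "H \<subseteq> kothe_bochner M (kothe_dual M E)"
    and A: "A \<in> sets M" "measure M A > 0" and "x0 \<noteq> 0"
  shows "\<exists>B\<in>sets M. \<exists>\<delta>>0. B \<subseteq> A \<and> measure M B > 0 \<and>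
    (\<forall>u\<in>borel_measurable M. (\<forall>x. 0 \<le> u x \<and> u x \<le> indicator B x) \<longrightarrow> \<delta> * (LINT x|M. u x) \<le> N u)"
proof -
  have sm: "strongly_measurable M (\<lambda>x. u x *\<^sub>R x0)" if u: "u \<in> borel_measurable M" for u :: "'a \<Rightarrow> real"
  proof -
    obtain s where s: "\<And>i. simple_function M (s i)" "\<And>x. x \<in> space M \<Longrightarrow> (\<lambda>i. s i x) \<longlonglongrightarrow> u x"
      using borel_measurable_implies_sequence_metric[OF u, of 0] by metis
    then have "AE x in M. (\<lambda>i. s i x *\<^sub>R x0) \<longlonglongrightarrow> u x *\<^sub>R x0"
      by (intro AE_I2 tendsto_intros)
    then show ?thesis unfolding strongly_measurable_def
      using simple_function_compose1[OF s(1)] by (intro exI[of _ "\<lambda>i x. s i x *\<^sub>R x0"]) auto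
  qed
  define f0 where "f0 x = indicat_real A x *\<^sub>R x0" for x
  have f0: "f0 \<in> kothe_bochner M E"
    unfolding f0_def[abs_def] using A by (intro bochner_bounded_mem(1)[of _ "norm x0"] sm) (auto simp: indicator_def)
  then obtain g where g: "g \<in> H" "kothe_bochner_norm N f0 = kothe_bochner_functional M g f0"
    and ball: "kothe_bochner_functional M g \<in> dual_unit_ball (kothe_bochner M E) (kothe_bochner_norm N)"
    using bd unfolding james_boundary_def by blast
  have g_sm: "strongly_measurable M g" and g_dual: "(\<lambda>x. norm (g x)) \<in> kothe_dual M E"
    using g(1) H by (auto simp: kothe_bochner_def)
  define w where "w x = blinfun_apply (g x) x0" for x
  have w_meas: "w \<in> borel_measurable (completion M)"
    unfolding w_def[abs_def] by (rule strongly_measurable_blinfun_apply[OF g_sm strongly_measurable_simple]) simp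
  have uw_int: "integrable (completion M) (\<lambda>x. u x * w x)"
    if u: "u \<in> borel_measurable M" "\<And>x. \<bar>u x\<bar> \<le> 1" for u
  proof (rule Bochner_Integration.integrable_bound)
    have "u \<in> E" using u by (intro bounded_mem(1)[of _ 1] measurable_completion)
    then have "integrable (completion M) (\<lambda>x. u x * norm (g x))" using g_dual by (simp add: kothe_dual_def)
    then show "integrable (completion M) (\<lambda>x. norm x0 * (u x * norm (g x)))" by simp
    show "(\<lambda>x. u x * w x) \<in> borel_measurable (completion M)"
      using w_meas measurable_completion[OF u(1)] by measurable
    have "\<bar>u x * w x\<bar> \<le> norm x0 * (\<bar>u x\<bar> * norm (g x))" for x
      using mult_left_mono[OF norm_blinfun[of "g x" x0], of "\<bar>u x\<bar>"] by (simp add: w_def abs_mult mult_ac)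
    then show "AE x in completion M. norm (u x * w x) \<le> norm (norm x0 * (u x * norm (g x)))"
      by (simp add: abs_mult)
  qed
  have "N (\<lambda>x. norm (f0 x)) \<noteq> 0"
  proof
    assume "N (\<lambda>x. norm (f0 x)) = 0"
    then have "AE x in M. x \<notin> A"
      using f0 norm_eq_0_iff[of "\<lambda>x. norm (f0 x)"] \<open>x0 \<noteq> 0\<close> by (auto simp: kothe_bochner_def f0_def indicator_def)
    then have "A \<in> null_sets M" using AE_iff_null_sets[OF A(1)] by blast
    then have "measure M A = 0" by (rule measure_eq_0_null_sets)
    with A show False by simp
  qed
  moreover have "N (\<lambda>x. norm (f0 x)) = (LINT x|completion M. indicator A x * w x)"
    using g(2) by (simp add: kothe_bochner_norm_def kothe_bochner_functional_def f0_def w_def blinfun.scaleR_right)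
  moreover have "0 \<le> N (\<lambda>x. norm (f0 x))"
    using dual_unit_ballD(3)[OF ball f0] abs_ge_zero order_trans unfolding kothe_bochner_norm_def by blast
  ultimately have pos: "0 < (LINT x|completion M. indicator A x * w x)" by simp
  define W where "W n = {x \<in> space (completion M). x \<in> A \<and> 1 / real (Suc n) < w x}" for n
  have W: "W n \<in> sets (completion M)" for n
  proof -
    have "{x \<in> space (completion M). 1 / real (Suc n) < w x} \<in> sets (completion M)"
      using borel_measurable_less[OF borel_measurable_const w_meas] by (simp add: pred_def)
    then have "A \<inter> {x \<in> space (completion M). 1 / real (Suc n) < w x} \<in> sets (completion M)"
      using A(1) by (intro sets.Int) auto
    also have "A \<inter> {x \<in> space (completion M). 1 / real (Suc n) < w x} = W n" by (auto simp: W_def)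
    finally show ?thesis .
  qed
  have "\<exists>n. emeasure (completion M) (W n) > 0"
  proof (rule ccontr)
    assume "\<not> ?thesis"
    then have "W n \<in> null_sets (completion M)" for n using W by (intro null_setsI) (auto simp: not_gr_zero)
    then have "AE x in completion M. \<forall>n. x \<notin> W n" unfolding AE_all_countable using AE_not_in by blast
    then have "AE x in completion M. indicator A x * w x \<le> 0"
      using AE_space
    proof eventually_elim
      case (elim x)
      have "w x \<le> 0" if "x \<in> A"
      proof (rule ccontr)
        assume "\<not> w x \<le> 0"
        then obtain n where "1 / real (Suc n) < w x" using reals_Archimedean[of "w x"] by (auto simp: inverse_eq_divide)
        then show False using elim that by (auto simp: W_def)
      qed
      then show ?case by (auto simp: indicator_def)
    qed
    then have "AE x in completion M. 0 \<le> - (indicator A x * w x)" by eventually_elim simp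
    then have "0 \<le> (LINT x|completion M. - (indicator A x * w x))" by (rule integral_nonneg_AE)
    with pos show False by simp
  qed
  then obtain n where n: "emeasure (completion M) (W n) > 0" by blast
  \<comment> \<open>\<open>W n\<close> is measurable for the completion only.\<close>
  define B where "B = main_part M (W n)"
  have BW: "B \<subseteq> W n" unfolding B_def using main_part_null_part_Un[OF W[of n]] by blast
  have B: "B \<in> sets M" unfolding B_def using W by simp
  have "measure M B > 0"
    using n W[of n] by (simp add: B_def emeasure_completion emeasure_eq_measure)
  define \<delta> where "\<delta> = 1 / (real (Suc n) * norm x0)"
  have "\<delta> > 0" using \<open>x0 \<noteq> 0\<close> by (simp add: \<delta>_def)
  have "\<delta> * (LINT x|M. u x) \<le> N u" if u: "u \<in> borel_measurable M" "\<And>x. 0 \<le> u x \<and> u x \<le> indicator B x" for u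
  proof -
    have u1: "\<bar>u x\<bar> \<le> 1" for x using u(2)[of x] by (cases "x \<in> B") auto
    have uE: "u \<in> E" by (rule bounded_mem(1)[OF measurable_completion[OF u(1)] u1])
    have uV: "(\<lambda>x. u x *\<^sub>R x0) \<in> kothe_bochner M E"
      using mult_right_mono[OF u1, of "norm x0"] by (intro bochner_bounded_mem(1)[of _ "norm x0"] sm u) auto
    have u_int: "integrable (completion M) u"
      by (rule integrable[OF uE])
    have "1 / real (Suc n) * (LINT x|M. u x) = (LINT x|completion M. 1 / real (Suc n) * u x)"
      using integral_completion[OF u(1)] by simp
    also have "\<dots> \<le> (LINT x|completion M. u x * w x)"
    proof (rule integral_mono)
      fix x
      show "1 / real (Suc n) * u x \<le> u x * w x"
      proof (cases "x \<in> B")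
        case True
        then have "1 / real (Suc n) \<le> w x" using BW by (auto simp: W_def)
        then show ?thesis using mult_left_mono[of "1 / real (Suc n)" "w x" "u x"] u(2)[of x] by (simp add: mult.commute)
      next
        case False
        then have "u x = 0" using u(2)[of x] by simp
        then show ?thesis by simp
      qed
    qed (use u_int uw_int[OF u(1) u1] in auto)
    also have "\<dots> = kothe_bochner_functional M g (\<lambda>x. u x *\<^sub>R x0)"
      by (simp add: kothe_bochner_functional_def w_def blinfun.scaleR_right)
    also have "\<dots> \<le> kothe_bochner_norm N (\<lambda>x. u x *\<^sub>R x0)"
      using dual_unit_ballD(3)[OF ball uV] by simp
    also have "\<dots> = norm x0 * N u"
    proof -
      have "(\<lambda>x. norm (u x *\<^sub>R x0)) = (\<lambda>x. norm x0 * u x)" using u(2) by (auto simp: mult.commute)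
      then show ?thesis unfolding kothe_bochner_norm_def using norm_scale[OF uE, of "norm x0"] by simp
    qed
    finally have "(1 / real (Suc n) * (LINT x|M. u x)) / norm x0 \<le> (norm x0 * N u) / norm x0"
      by (rule divide_right_mono) simp
    then show ?thesis using \<open>x0 \<noteq> 0\<close> by (simp add: \<delta>_def)
  qed
  moreover have "B \<subseteq> A" using BW by (auto simp: W_def)
  ultimately show ?thesis using B \<open>measure M B > 0\<close> \<open>\<delta> > 0\<close> by blast
qed

theorem corollary1p2:
  fixes M :: "'a measure"
    and E :: "('a \<Rightarrow> real) set"
    and N :: "('a \<Rightarrow> real) \<Rightarrow> real"
  assumes "kothe_function_space M E N"
    and "\<not> purely_atomic M"
    and "order_continuous M E N"
    and "james_boundary
           (kothe_bochner M E :: ('a \<Rightarrow> 'x::banach) set)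
           (kothe_bochner_norm N)
           (kothe_bochner_functional M `
              {g \<in> kothe_bochner M (kothe_dual M E).
                 kothe_bochner_norm (kothe_dual_norm M E N) g \<le> 1})"
  shows "radon_nikodym_property TYPE('b) TYPE('x \<Rightarrow>\<^sub>L real)"
proof (rule ccontr)
  assume "\<not> radon_nikodym_property TYPE('b) TYPE('x \<Rightarrow>\<^sub>L real)"
  then obtain h :: "bool list \<Rightarrow> 'x" and c and e :: "bool list \<Rightarrow> 'x \<Rightarrow>\<^sub>L real" and \<epsilon> L
    where pos: "\<epsilon> > 0" "L > 0" and h: "\<And>s. norm (h s) \<le> 1" and e: "\<And>s. norm (e s) \<le> L"
    and left: "\<And>u s. c s + \<epsilon> \<le> blinfun_apply (e (u @ False # s)) (h s)"
    and right: "\<And>u s. blinfun_apply (e (u @ True # s)) (h s) \<le> c s"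
    using not_radon_nikodym_tree by metis
  have "h [] \<noteq> 0"
  proof
    assume "h [] = 0"
    then show False using left[of "[]" "[]"] right[of "[]" "[]"] pos by simp
  qed
  interpret kothe_function_space M E N by fact
  define H where "H = {g :: 'a \<Rightarrow> 'x \<Rightarrow>\<^sub>L real. g \<in> kothe_bochner M (kothe_dual M E) \<and>
    kothe_bochner_norm (kothe_dual_norm M E N) g \<le> 1}"
  have bd: "james_boundary (kothe_bochner M E) (kothe_bochner_norm N) (kothe_bochner_functional M ` H)"
    using assms(4) unfolding H_def .
  have H: "H \<subseteq> kothe_bochner M (kothe_dual M E)" by (auto simp: H_def)
  obtain A0 where A0: "A0 \<in> sets M" "measure M A0 > 0" and na: "\<And>B. B \<subseteq> A0 \<Longrightarrow> \<not> atom M B"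
    using assms(2) unfolding purely_atomic_def by (auto simp: emeasure_eq_measure)
  \<comment> \<open>The tree of sets grows inside an atomless set on which the norm of \<open>E\<close> dominates a
      multiple of that of \<open>L\<^sub>1\<close>.\<close>
  obtain B \<delta> where B: "B \<in> sets M" "B \<subseteq> A0" "measure M B > 0" and \<delta>: "\<delta> > 0"
    and low: "\<And>u. u \<in> borel_measurable M \<Longrightarrow> (\<And>x. 0 \<le> u x \<and> u x \<le> indicator B x) \<Longrightarrow>
      \<delta> * (LINT x|M. u x) \<le> N u"
    using boundary_lower_bound[OF bd H A0 \<open>h [] \<noteq> 0\<close>] by blast
  obtain A where tree: "dyadic_tree M A" and A_Nil: "A [] = B"
    using exists_dyadic_tree[OF B(1)] na B(2) by blast
  interpret tree: dyadic_tree M A by (rule tree)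
  let ?f = "tree.haar_sum h"
  define \<eta> where "\<eta> = \<delta> * (2 * \<epsilon> / 9 * measure M B / L)"
  have "\<eta> > 0" using \<delta> pos B by (simp add: \<eta>_def)
  have ball: "simple_function M y \<and> (\<forall>t. norm (y t) \<le> 1)" if "y \<in> tail_hull ?f k" for y k
    by (rule tail_hull_simple_ball[OF tree.simple_haar_sum tree.norm_haar_sum_le that]) (rule h)
  have "\<exists>y\<in>tail_hull ?f 0. kothe_bochner_norm N y < \<eta>"
  proof (rule james_boundary_null_sequence[OF bochner_add(1) bochner_scaleR(1) bochner_add(2) bochner_scaleR(2) bd])
    show "?f n \<in> kothe_bochner M E" for n
      by (rule bochner_bounded_mem(1)[OF strongly_measurable_simple[OF tree.simple_haar_sum] tree.norm_haar_sum_le[OF h]])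
    show "kothe_bochner_norm N y \<le> 1 * N (indicator (space M))" if "y \<in> tail_hull ?f 0" for y
      using ball[OF that] by (intro bochner_bounded_mem(2) strongly_measurable_simple) auto
    show "\<exists>g\<in>kothe_bochner M E.
        (\<lambda>n. kothe_bochner_norm N (\<lambda>t. g t - (\<Sum>i<n. (1/2) ^ Suc i *\<^sub>R y i t))) \<longlonglongrightarrow> 0"
      if "\<And>k. y k \<in> tail_hull ?f k" for y
      using ball[OF that] by (intro bochner_geometric_series) auto
    fix \<phi> assume "\<phi> \<in> kothe_bochner_functional M ` H"
    then obtain g where g: "g \<in> H" "\<phi> = kothe_bochner_functional M g" by blast
    then have "strongly_measurable M g" and dual: "(\<lambda>x. norm (g x)) \<in> kothe_dual M E"
      using H by (auto simp: kothe_bochner_def)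
    moreover have "(\<lambda>x. 1) \<in> E" by (rule bounded_mem(1)[of _ 1]) auto
    then have "integrable (completion M) (\<lambda>x. norm (g x))"
      using dual by (force simp: kothe_dual_def)
    ultimately show "(\<lambda>n. \<phi> (?f n)) \<longlonglongrightarrow> 0"
      unfolding g(2) kothe_bochner_functional_def by (intro tree.haar_sum_weakly_null h)
  qed (assumption | rule \<open>\<eta> > 0\<close>)+
  then obtain y where y: "y \<in> tail_hull ?f 0" "kothe_bochner_norm N y < \<eta>" by blast
  have support: "y t = 0" if "t \<notin> B" for t
    using y(1)
  proof induction
    case (generator n)
    then show ?case using that A_Nil by (simp add: tree.haar_sum_outside)
  qed simp
  have "\<eta> \<le> \<delta> * (LINT t|M. norm (y t))"
    unfolding \<eta>_def A_Nil[symmetric] using \<delta> pos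
    by (intro mult_left_mono tree.integral_haar_sum_lower_bound[OF h e _ _ left right y(1)]) auto
  also have "\<dots> \<le> N (\<lambda>t. norm (y t))"
  proof (rule low)
    show "(\<lambda>t. norm (y t)) \<in> borel_measurable M"
      using ball[OF y(1)] by (intro borel_measurable_simple_function[OF simple_function_compose1]) blast
    show "0 \<le> norm (y t) \<and> norm (y t) \<le> indicator B t" for t
      using ball[OF y(1)] support[of t] by (cases "t \<in> B") auto
  qed
  finally show False using y(2) by (simp add: kothe_bochner_norm_def)
qed

end
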